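(* Mumbling $H_\mu$ with basis $\mathit{LTL}$ and unique mumbling is strictly more expressive than stuttering $H_\mu$ with basis $\mathit{LTL}$ and unique stuttering.
   Context: Fix a finite set $\mathit{AP}$. A trace is an infinite sequence $P_0m_0P_1m_1\dots$ with $P_i\subseteq\mathit{AP}$, $m_i\in\{\mathit{int},\mathit{call},\mathit{ret}\}$; $\mathit{tr}(i)=P_i$. Successor functions: $\mathit{succ}_\mathsf{g}(\mathit{tr},i)=i+1$; $\mathit{succ}_\mathsf{a}(\mathit{tr},i)=i+1$ if $m_i=\mathit{int}$, and if $m_i=\mathit{call}$ the least $j>i$ such that among $m_i,\dots,m_{j-1}$ the numbers of $\mathit{call}$ and $\mathit{ret}$ coincide (undefined if none), undefined if $m_i=\mathit{ret}$; $\mathit{succ}_\mathsf{c}(\mathit{tr},i)$ the largest $j<i$ with $m_j=\mathit{call}$ such that among $m_{j+1},\dots,m_{i-1}$ the numbers of $\mathit{call}$ and $\mathit{ret}$ coincide (undefined if none). Mumbling $H_\mu$: trace formulae $\delta ::= \mathit{ap}\mid Y\mid\delta\lor\delta\mid\lnot\delta\mid\bigcirc^\mathsf{f}\delta\mid\mu Y.\delta$ ($\mathsf{f}\in\{\mathsf{g},\mathsf{a},\mathsf{c}\}$); multitrace formulae $\psi ::= [\delta]_\pi\mid X\mid\psi\lor\psi\mid\lnot\psi\mid\bigcirc^\Delta\psi\mid\mu X.\psi$ with $\Delta$ mapping trace variables to trace formulae; hyperproperty formulae $\varphi ::= \exists\pi.\varphi\mid\forall\pi.\varphi\mid\psi$;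 fixpoint variables occur positively; closed = all variables bound. Trace semantics $\llbracket\delta\rrbracket^{\mathit{tr}}_{\mathcal{V}}\subseteq\mathbb{N}_0$: $\mathit{ap}\mapsto\{i\mid\mathit{ap}\in\mathit{tr}(i)\}$, $Y\mapsto\mathcal{V}(Y)$, union, complement, $\bigcirc^\mathsf{f}\delta\mapsto\{i\mid\mathit{succ}_\mathsf{f}(\mathit{tr},i)$ defined and in $\llbracket\delta\rrbracket\}$, $\mu Y.\delta\mapsto\bigcap\{I\mid\llbracket\delta\rrbracket_{\mathcal{V}[Y\mapsto I]}\subseteq I\}$. $\mathit{succ}_\delta(\mathit{tr},i)=\min\{j>i\mid j\in\llbracket\delta\rrbracket^{\mathit{tr}}\}$ if nonempty, else $i+1$; $\mathit{succ}_\Delta(\Pi,v)$ componentwise for a trace assignment $\Pi$ on $\pi_1,\dots,\pi_n$. $\llbracket\psi\rrbracket^\Pi_{\mathcal{W}}\subseteq\mathbb{N}_0^n$: $[\delta]_{\pi_j}\mapsto\{v\mid v_j\in\llbracket\delta\rrbracket^{\Pi(\pi_j)}\}$, $X\mapsto\mathcal{W}(X)$, Boolean as usual, $\bigcirc^\Delta\psi\mapsto\{v\mid\mathit{succ}_\Delta(\Pi,v)\in\llbracket\psi\rrbracket\}$, $\mu X$ least fixpoint. $\Pi\models_\mathcal{T}\exists\pi.\varphi$ iff some $\mathit{tr}\in\mathcal{T}$ gives $\Pi[\pi\mapsto\mathit{tr}]\models_\mathcal{T}\varphi$; $\forall$ for all; $\Pi\models_\mathcal{T}\psi$ iff $(0,\dots,0)\in\llbracket\psi\rrbracket^\Pi$.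 For closed $\varphi$ and a set of traces $\mathcal{T}$, $\mathcal{T}\models\varphi$ iff the empty assignment satisfies $\varphi$ over $\mathcal{T}$. Stuttering $H_\mu$ is identical except that multitrace next operators are $\bigcirc^\Gamma\psi$ with $\Gamma$ mapping each trace variable to a finite set of trace formulae; for a finite set $\gamma$, $\mathit{succ}_\gamma(\mathit{tr},i)=\min\{j>i\mid$ for some $\delta\in\gamma$: $i\in\llbracket\delta\rrbracket^{\mathit{tr}}\not\Leftrightarrow j\in\llbracket\delta\rrbracket^{\mathit{tr}}\}$ if nonempty, else $i+1$; $\mathit{succ}_\Gamma$ componentwise and $\llbracket\bigcirc^\Gamma\psi\rrbracket=\{v\mid\mathit{succ}_\Gamma(\Pi,v)\in\llbracket\psi\rrbracket\}$. Unique mumbling (stuttering): all multitrace next operators use the same $\Delta$ ($\Gamma$). Base formulae: trace formulae occurring in tests $[\delta]_\pi$ or as values $\Delta(\pi)$ (elements of $\Gamma(\pi)$). Basis $\mathit{LTL}$: all base formulae are LTL formulae, i.e. built from atomic propositions using $\lnot$, $\lor$, $\bigcirc^\mathsf{g}$ and $\delta_1\,\mathcal{U}\,\delta_2:=\mu Y.(\delta_2\lor(\delta_1\land\bigcirc^\mathsf{g}Y))$ as the only fixpoint construct. $L_1$ is at least as expressive as $L_2$ if for every closed hyperproperty formula $\varphi$ of $L_2$ there is a closed $\varphi'$ of $L_1$ with $\mathcal{T}\models\varphi$ iff $\mathcal{T}\models\varphi'$ for all sets of traces $\mathcal{T}$; strictly more expressive means at least as expressive but not conversely. *)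

theory Defs
  imports Main
begin

datatype move = MInt | MCall | MRet

text \<open>A trace over the finite set of atomic propositions \<open>'a\<close>:
  position i carries the pair (P_i, m_i).\<close>
type_synonym 'a trace = "nat \<Rightarrow> 'a set \<times> move"

definition mv :: "'a trace \<Rightarrow> nat \<Rightarrow> move" where
  "mv tr i = snd (tr i)"

definition balanced :: "'a trace \<Rightarrow> nat \<Rightarrow> nat \<Rightarrow> bool" where
  "balanced tr a b \<longleftrightarrow>
     card {k. a \<le> k \<and> k < b \<and> mv tr k = MCall} = card {k. a \<le> k \<and> k < b \<and> mv tr k = MRet}"

datatype succ_kind = SG | SA | SC

definition succ_a :: "'a trace \<Rightarrow> nat \<Rightarrow> nat option" where
  "succ_a tr i =
     (case mv tr i of
        MInt \<Rightarrow> Some (Suc i)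
      | MCall \<Rightarrow> (if \<exists>j>i. balanced tr i j then Some (LEAST j. j > i \<and> balanced tr i j) else None)
      | MRet \<Rightarrow> None)"

definition succ_c :: "'a trace \<Rightarrow> nat \<Rightarrow> nat option" where
  "succ_c tr i =
     (if \<exists>j<i. mv tr j = MCall \<and> balanced tr (Suc j) i
      then Some (Max {j. j < i \<and> mv tr j = MCall \<and> balanced tr (Suc j) i}) else None)"

fun succ_f :: "succ_kind \<Rightarrow> 'a trace \<Rightarrow> nat \<Rightarrow> nat option" where
  "succ_f SG tr i = Some (Suc i)"
| "succ_f SA tr i = succ_a tr i"
| "succ_f SC tr i = succ_c tr i"

datatype 'a tf =
    TAP 'a
  | TVar nat
  | TOr "'a tf" "'a tf"
  | TNot "'a tf"
  | TNext succ_kind "'a tf"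
  | TMu nat "'a tf"

primrec tsem :: "'a trace \<Rightarrow> (nat \<Rightarrow> nat set) \<Rightarrow> 'a tf \<Rightarrow> nat set" where
  "tsem tr V (TAP p) = {i. p \<in> fst (tr i)}"
| "tsem tr V (TVar Y) = V Y"
| "tsem tr V (TOr d1 d2) = tsem tr V d1 \<union> tsem tr V d2"
| "tsem tr V (TNot d) = - tsem tr V d"
| "tsem tr V (TNext f d) = {i. \<exists>j. succ_f f tr i = Some j \<and> j \<in> tsem tr V d}"
| "tsem tr V (TMu Y d) = \<Inter> {I. tsem tr (V(Y := I)) d \<subseteq> I}"

text \<open>Semantics of a closed trace formula (valuation irrelevant; we use the empty one).\<close>
definition tsem0 :: "'a trace \<Rightarrow> 'a tf \<Rightarrow> nat set" where
  "tsem0 tr d = tsem tr (\<lambda>_. {}) d"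

primrec tf_fv :: "'a tf \<Rightarrow> nat set" where
  "tf_fv (TAP p) = {}"
| "tf_fv (TVar Y) = {Y}"
| "tf_fv (TOr d1 d2) = tf_fv d1 \<union> tf_fv d2"
| "tf_fv (TNot d) = tf_fv d"
| "tf_fv (TNext f d) = tf_fv d"
| "tf_fv (TMu Y d) = tf_fv d - {Y}"

text \<open>\<open>tf_pol Y p d\<close>: every free occurrence of Y in d has polarity p
  (True = under an even number of negations).\<close>
primrec tf_pol :: "nat \<Rightarrow> bool \<Rightarrow> 'a tf \<Rightarrow> bool" where
  "tf_pol Y p (TAP a) = True"
| "tf_pol Y p (TVar Z) = (Z = Y \<longrightarrow> p)"
| "tf_pol Y p (TOr d1 d2) = (tf_pol Y p d1 \<and> tf_pol Y p d2)"
| "tf_pol Y p (TNot d) = tf_pol Y (\<not> p) d"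
| "tf_pol Y p (TNext f d) = tf_pol Y p d"
| "tf_pol Y p (TMu Z d) = (Z = Y \<or> tf_pol Y p d)"

primrec tf_wf :: "'a tf \<Rightarrow> bool" where
  "tf_wf (TAP a) = True"
| "tf_wf (TVar Y) = True"
| "tf_wf (TOr d1 d2) = (tf_wf d1 \<and> tf_wf d2)"
| "tf_wf (TNot d) = tf_wf d"
| "tf_wf (TNext f d) = tf_wf d"
| "tf_wf (TMu Y d) = (tf_pol Y True d \<and> tf_wf d)"

definition tf_closed_wf :: "'a tf \<Rightarrow> bool" where
  "tf_closed_wf d \<longleftrightarrow> tf_fv d = {} \<and> tf_wf d"

definition TAnd :: "'a tf \<Rightarrow> 'a tf \<Rightarrow> 'a tf" where
  "TAnd d1 d2 = TNot (TOr (TNot d1) (TNot d2))"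

text \<open>d1 U d2 := mu Y. (d2 \<or> (d1 \<and> next^g Y)); Y is arbitrary (LTL formulas are closed,
  so no capture occurs).\<close>
definition TUntil :: "nat \<Rightarrow> 'a tf \<Rightarrow> 'a tf \<Rightarrow> 'a tf" where
  "TUntil Y d1 d2 = TMu Y (TOr d2 (TAnd d1 (TNext SG (TVar Y))))"

inductive is_ltl :: "'a tf \<Rightarrow> bool" where
  ltl_ap: "is_ltl (TAP p)"
| ltl_not: "is_ltl d \<Longrightarrow> is_ltl (TNot d)"
| ltl_or: "is_ltl d1 \<Longrightarrow> is_ltl d2 \<Longrightarrow> is_ltl (TOr d1 d2)"
| ltl_next: "is_ltl d \<Longrightarrow> is_ltl (TNext SG d)"
| ltl_until: "is_ltl d1 \<Longrightarrow> is_ltl d2 \<Longrightarrow> is_ltl (TUntil Y d1 d2)"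

text \<open>Trace variables, multitrace fixpoint variables: nat. A trace assignment is a
  total map from trace variables to traces, a position vector a map to positions;
  only the (quantifier-bound) variables of a closed formula matter.\<close>

datatype ('a, 'n) mf =
    MTest "'a tf" nat
  | MVar nat
  | MOr "('a, 'n) mf" "('a, 'n) mf"
  | MNot "('a, 'n) mf"
  | MNext 'n "('a, 'n) mf"
  | MMu nat "('a, 'n) mf"

datatype ('a, 'n) hf =
    HEx nat "('a, 'n) hf"
  | HAll nat "('a, 'n) hf"
  | HBody "('a, 'n) mf"

type_synonym ('a, 'n) stepfun = "'n \<Rightarrow> (nat \<Rightarrow> 'a trace) \<Rightarrow> (nat \<Rightarrow> nat) \<Rightarrow> (nat \<Rightarrow> nat)"

primrec msem :: "('a, 'n) stepfun \<Rightarrow> (nat \<Rightarrow> 'a trace) \<Rightarrow> (nat \<Rightarrow> (nat \<Rightarrow> nat) set)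
                  \<Rightarrow> ('a, 'n) mf \<Rightarrow> (nat \<Rightarrow> nat) set" where
  "msem st Pi W (MTest d p) = {v. v p \<in> tsem0 (Pi p) d}"
| "msem st Pi W (MVar X) = W X"
| "msem st Pi W (MOr s1 s2) = msem st Pi W s1 \<union> msem st Pi W s2"
| "msem st Pi W (MNot s) = - msem st Pi W s"
| "msem st Pi W (MNext l s) = {v. st l Pi v \<in> msem st Pi W s}"
| "msem st Pi W (MMu X s) = \<Inter> {I. msem st Pi (W(X := I)) s \<subseteq> I}"

primrec hsat :: "('a, 'n) stepfun \<Rightarrow> 'a trace set \<Rightarrow> (nat \<Rightarrow> 'a trace) \<Rightarrow> ('a, 'n) hf \<Rightarrow> bool" where
  "hsat st T Pi (HEx p f) = (\<exists>tr\<in>T. hsat st T (Pi(p := tr)) f)"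
| "hsat st T Pi (HAll p f) = (\<forall>tr\<in>T. hsat st T (Pi(p := tr)) f)"
| "hsat st T Pi (HBody s) = ((\<lambda>_. 0) \<in> msem st Pi (\<lambda>_. {}) s)"

text \<open>T |= phi: satisfaction under the empty assignment (for closed formulas the
  initial assignment is irrelevant).\<close>
definition hmodels :: "('a, 'n) stepfun \<Rightarrow> 'a trace set \<Rightarrow> ('a, 'n) hf \<Rightarrow> bool" where
  "hmodels st T f = hsat st T (\<lambda>_. undefined) f"

primrec mf_fv :: "('a, 'n) mf \<Rightarrow> nat set" where
  "mf_fv (MTest d p) = {}"
| "mf_fv (MVar X) = {X}"
| "mf_fv (MOr s1 s2) = mf_fv s1 \<union> mf_fv s2"
| "mf_fv (MNot s) = mf_fv s"
| "mf_fv (MNext l s) = mf_fv s"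
| "mf_fv (MMu X s) = mf_fv s - {X}"

primrec mf_pol :: "nat \<Rightarrow> bool \<Rightarrow> ('a, 'n) mf \<Rightarrow> bool" where
  "mf_pol X p (MTest d q) = True"
| "mf_pol X p (MVar Z) = (Z = X \<longrightarrow> p)"
| "mf_pol X p (MOr s1 s2) = (mf_pol X p s1 \<and> mf_pol X p s2)"
| "mf_pol X p (MNot s) = mf_pol X (\<not> p) s"
| "mf_pol X p (MNext l s) = mf_pol X p s"
| "mf_pol X p (MMu Z s) = (Z = X \<or> mf_pol X p s)"

primrec mf_wf :: "('a, 'n) mf \<Rightarrow> bool" where
  "mf_wf (MTest d q) = True"
| "mf_wf (MVar X) = True"
| "mf_wf (MOr s1 s2) = (mf_wf s1 \<and> mf_wf s2)"
| "mf_wf (MNot s) = mf_wf s"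
| "mf_wf (MNext l s) = mf_wf s"
| "mf_wf (MMu X s) = (mf_pol X True s \<and> mf_wf s)"

primrec mf_tvars :: "('a, 'n) mf \<Rightarrow> nat set" where
  "mf_tvars (MTest d p) = {p}"
| "mf_tvars (MVar X) = {}"
| "mf_tvars (MOr s1 s2) = mf_tvars s1 \<union> mf_tvars s2"
| "mf_tvars (MNot s) = mf_tvars s"
| "mf_tvars (MNext l s) = mf_tvars s"
| "mf_tvars (MMu X s) = mf_tvars s"

primrec mf_tests :: "('a, 'n) mf \<Rightarrow> 'a tf set" where
  "mf_tests (MTest d p) = {d}"
| "mf_tests (MVar X) = {}"
| "mf_tests (MOr s1 s2) = mf_tests s1 \<union> mf_tests s2"
| "mf_tests (MNot s) = mf_tests s"
| "mf_tests (MNext l s) = mf_tests s"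
| "mf_tests (MMu X s) = mf_tests s"

primrec mf_labels :: "('a, 'n) mf \<Rightarrow> 'n set" where
  "mf_labels (MTest d p) = {}"
| "mf_labels (MVar X) = {}"
| "mf_labels (MOr s1 s2) = mf_labels s1 \<union> mf_labels s2"
| "mf_labels (MNot s) = mf_labels s"
| "mf_labels (MNext l s) = insert l (mf_labels s)"
| "mf_labels (MMu X s) = mf_labels s"

primrec hf_matrix :: "('a, 'n) hf \<Rightarrow> ('a, 'n) mf" where
  "hf_matrix (HEx p f) = hf_matrix f"
| "hf_matrix (HAll p f) = hf_matrix f"
| "hf_matrix (HBody s) = s"

primrec hf_bound :: "('a, 'n) hf \<Rightarrow> nat set" where
  "hf_bound (HEx p f) = insert p (hf_bound f)"
| "hf_bound (HAll p f) = insert p (hf_bound f)"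
| "hf_bound (HBody s) = {}"

definition hf_base :: "('n \<Rightarrow> 'a tf set) \<Rightarrow> ('a, 'n) hf \<Rightarrow> 'a tf set" where
  "hf_base lab f = mf_tests (hf_matrix f) \<union> \<Union> (lab ` mf_labels (hf_matrix f))"

definition hf_closed_wf :: "('n \<Rightarrow> 'a tf set) \<Rightarrow> ('a, 'n) hf \<Rightarrow> bool" where
  "hf_closed_wf lab f \<longleftrightarrow>
     mf_fv (hf_matrix f) = {} \<and> mf_wf (hf_matrix f) \<and>
     mf_tvars (hf_matrix f) \<subseteq> hf_bound f \<and>
     (\<forall>d \<in> hf_base lab f. tf_closed_wf d)"

definition hf_unique :: "('a, 'n) hf \<Rightarrow> bool" where
  "hf_unique f \<longleftrightarrow> (\<forall>l1 \<in> mf_labels (hf_matrix f). \<forall>l2 \<in> mf_labels (hf_matrix f). l1 = l2)"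

definition hf_basis_ltl :: "('n \<Rightarrow> 'a tf set) \<Rightarrow> ('a, 'n) hf \<Rightarrow> bool" where
  "hf_basis_ltl lab f \<longleftrightarrow> (\<forall>d \<in> hf_base lab f. is_ltl d)"

type_synonym 'a mlabel = "nat \<Rightarrow> 'a tf"

definition succ_delta :: "'a tf \<Rightarrow> 'a trace \<Rightarrow> nat \<Rightarrow> nat" where
  "succ_delta d tr i =
     (if {j. j > i \<and> j \<in> tsem0 tr d} \<noteq> {} then (LEAST j. j > i \<and> j \<in> tsem0 tr d) else Suc i)"

definition mstep :: "('a, 'a mlabel) stepfun" where
  "mstep Delta Pi v = (\<lambda>p. succ_delta (Delta p) (Pi p) (v p))"

definition mlab :: "'a mlabel \<Rightarrow> 'a tf set" where
  "mlab Delta = range Delta"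

definition mumbling_ltl_unique :: "('a, 'a mlabel) hf \<Rightarrow> bool" where
  "mumbling_ltl_unique f \<longleftrightarrow> hf_closed_wf mlab f \<and> hf_basis_ltl mlab f \<and> hf_unique f"

type_synonym 'a slabel = "nat \<Rightarrow> 'a tf set"   \<comment> \<open>Gamma, each value a finite set\<close>

definition succ_gamma :: "'a tf set \<Rightarrow> 'a trace \<Rightarrow> nat \<Rightarrow> nat" where
  "succ_gamma g tr i =
     (if {j. j > i \<and> (\<exists>d\<in>g. (i \<in> tsem0 tr d) \<noteq> (j \<in> tsem0 tr d))} \<noteq> {}
      then (LEAST j. j > i \<and> (\<exists>d\<in>g. (i \<in> tsem0 tr d) \<noteq> (j \<in> tsem0 tr d)))
      else Suc i)"

definition sstep :: "('a, 'a slabel) stepfun" where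
  "sstep Gamma Pi v = (\<lambda>p. succ_gamma (Gamma p) (Pi p) (v p))"

definition slab :: "'a slabel \<Rightarrow> 'a tf set" where
  "slab Gamma = \<Union> (range Gamma)"

definition stuttering_ltl_unique :: "('a, 'a slabel) hf \<Rightarrow> bool" where
  "stuttering_ltl_unique f \<longleftrightarrow> hf_closed_wf slab f \<and> hf_basis_ltl slab f \<and> hf_unique f
      \<and> (\<forall>Gamma \<in> mf_labels (hf_matrix f). \<forall>p. finite (Gamma p))"

definition at_least_as_expressive ::
  "('f1 \<Rightarrow> bool) \<Rightarrow> ('a trace set \<Rightarrow> 'f1 \<Rightarrow> bool) \<Rightarrow>
   ('f2 \<Rightarrow> bool) \<Rightarrow> ('a trace set \<Rightarrow> 'f2 \<Rightarrow> bool) \<Rightarrow> bool" where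
  "at_least_as_expressive L1 sat1 L2 sat2 \<longleftrightarrow>
     (\<forall>f. L2 f \<longrightarrow> (\<exists>f'. L1 f' \<and> (\<forall>T. sat1 T f' \<longleftrightarrow> sat2 T f)))"

definition strictly_more_expressive ::
  "('f1 \<Rightarrow> bool) \<Rightarrow> ('a trace set \<Rightarrow> 'f1 \<Rightarrow> bool) \<Rightarrow>
   ('f2 \<Rightarrow> bool) \<Rightarrow> ('a trace set \<Rightarrow> 'f2 \<Rightarrow> bool) \<Rightarrow> bool" where
  "strictly_more_expressive L1 sat1 L2 sat2 \<longleftrightarrow>
     at_least_as_expressive L1 sat1 L2 sat2 \<and> \<not> at_least_as_expressive L2 sat2 L1 sat1"

end

theory Submission
  imports Defs
begin

text \<open>A matrix with a single label is evaluated along one path of position vectors, hence is a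
  linear-time fixpoint formula over a word.

  Stuttering by \<open>\<Gamma>\<close> is simulated by mumbling towards the positions at which some formula of
  \<open>\<Gamma>(\<pi>)\<close> is about to change its value; up to the first step, the two paths differ by a shift by one
  position, which tests can undo with next operators.

  Conversely, consider one trace starting with \<open>m\<close> empty letters followed by \<open>n\<close> letters \<open>{a}\<close>. A
  mumbling formula with two copies of the trace, one moving from \<open>a\<close> to \<open>a\<close> and one moving letter by
  letter, reaches the end of the \<open>a\<close>-block in the first copy when the second is at position \<open>n\<close>, and
  so decides \<open>m \<le> n\<close>. A stuttering path over LTL formulae either moves letter by letter or does not
  notice long blocks being stretched; on an otherwise periodic trace the paths of the second kind
  contribute an eventually periodic word independent of \<open>m\<close> and \<open>n\<close>. Since a formula induces only
  finitely many types of suffixes, pumping yields \<open>n < m \<le> n'\<close> that it does not distinguish.\<close>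

section \<open>Multitrace formulae over abstract transition structures\<close>

text \<open>Points and successors are abstract, so that one matrix can be read over position vectors
  as well as over the word of steps along a path, and the two readings compared by maps between the
  point sets.\<close>

primrec gsem :: "('a tf \<Rightarrow> nat \<Rightarrow> 'v \<Rightarrow> bool) \<Rightarrow> ('n \<Rightarrow> 'v \<Rightarrow> 'v) \<Rightarrow> (nat \<Rightarrow> 'v set)
    \<Rightarrow> ('a, 'n) mf \<Rightarrow> 'v set" where
  "gsem t nx W (MTest d p) = {v. t d p v}"
| "gsem t nx W (MVar X) = W X"
| "gsem t nx W (MOr s1 s2) = gsem t nx W s1 \<union> gsem t nx W s2"
| "gsem t nx W (MNot s) = - gsem t nx W s"
| "gsem t nx W (MNext l s) = {v. nx l v \<in> gsem t nx W s}"
| "gsem t nx W (MMu X s) = \<Inter> {I. gsem t nx (W(X := I)) s \<subseteq> I}"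

lemma msem_eq_gsem: "msem st Pi W s = gsem (\<lambda>d p v. v p \<in> tsem0 (Pi p) d) (\<lambda>l. st l Pi) W s"
  by (induction s arbitrary: W) auto

text \<open>Both polarities are proved together because negation exchanges them.\<close>

lemma gsem_mono_aux:
  assumes "I \<subseteq> J"
  shows "(mf_pol X True s \<longrightarrow> gsem t nx (W(X := I)) s \<subseteq> gsem t nx (W(X := J)) s) \<and>
    (mf_pol X False s \<longrightarrow> gsem t nx (W(X := J)) s \<subseteq> gsem t nx (W(X := I)) s)"
proof (induction s arbitrary: W)
  case (MMu Z s)
  show ?case
  proof (cases "Z = X")
    case False
    then have "W(X := K, Z := L) = W(Z := L, X := K)" for K L
      by (simp add: fun_upd_twist)
    with MMu.IH[of "W(Z := L)" for L]
    have mono: "mf_pol X True s \<Longrightarrow> gsem t nx (W(X := I, Z := L)) s \<subseteq> gsem t nx (W(X := J, Z := L)) s"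
      "mf_pol X False s \<Longrightarrow> gsem t nx (W(X := J, Z := L)) s \<subseteq> gsem t nx (W(X := I, Z := L)) s" for L
      by metis+
    have "mf_pol X True s \<Longrightarrow> gsem t nx (W(X := I)) (MMu Z s) \<subseteq> gsem t nx (W(X := J)) (MMu Z s)"
      unfolding gsem.simps by (rule Inter_anti_mono, rule Collect_mono) (metis mono(1) subset_trans)
    moreover have "mf_pol X False s \<Longrightarrow> gsem t nx (W(X := J)) (MMu Z s) \<subseteq> gsem t nx (W(X := I)) (MMu Z s)"
      unfolding gsem.simps by (rule Inter_anti_mono, rule Collect_mono) (metis mono(2) subset_trans)
    ultimately show ?thesis using False
      by (simp del: gsem.simps fun_upd_apply)
  qed (simp del: fun_upd_apply)
next
  case (MOr s1 s2)
  show ?case using MOr.IH[of W] by (auto simp del: fun_upd_apply)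
qed (use assms in auto)

lemma gsem_mono:
  "mf_pol X True s \<Longrightarrow> I \<subseteq> J \<Longrightarrow> gsem t nx (W(X := I)) s \<subseteq> gsem t nx (W(X := J)) s"
  using gsem_mono_aux by blast

lemma gsem_MMu_lowerbound: "gsem t nx (W(X := I)) s \<subseteq> I \<Longrightarrow> gsem t nx W (MMu X s) \<subseteq> I"
  by auto

lemma gsem_MMu_unfold:
  assumes "mf_pol X True s"
  shows "gsem t nx W (MMu X s) = gsem t nx (W(X := gsem t nx W (MMu X s))) s"
proof -
  have mono: "mono (\<lambda>I. gsem t nx (W(X := I)) s)"
    by (intro monoI gsem_mono[OF assms])
  have lfp: "gsem t nx W (MMu X s) = lfp (\<lambda>I. gsem t nx (W(X := I)) s)"
    by (simp add: lfp_def)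
  show ?thesis unfolding lfp by (rule lfp_unfold[OF mono])
qed

text \<open>A point of a least fixpoint never rests on itself: if \<open>k\<close> did not follow
  from the fixpoint without \<open>k\<close>, removing it would leave a smaller prefixed
  point.\<close>

lemma mem_gsem_MMu_iff:
  assumes "mf_pol X True s"
  shows "k \<in> gsem t nx W (MMu X s) \<longleftrightarrow> k \<in> gsem t nx (W(X := gsem t nx W (MMu X s) - {k})) s"
    (is "k \<in> ?M \<longleftrightarrow> k \<in> ?F (?M - {k})")
proof
  assume k: "k \<in> ?M"
  show "k \<in> ?F (?M - {k})"
  proof (rule ccontr)
    assume n: "k \<notin> ?F (?M - {k})"
    have "?F (?M - {k}) \<subseteq> ?F ?M" by (rule gsem_mono[OF assms]) auto
    also have "\<dots> = ?M" by (rule gsem_MMu_unfold[OF assms, symmetric])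
    finally have "?M \<subseteq> ?M - {k}" using n by (intro gsem_MMu_lowerbound) blast
    with k show False by blast
  qed
next
  assume "k \<in> ?F (?M - {k})"
  moreover have "?F (?M - {k}) \<subseteq> ?F ?M" by (rule gsem_mono[OF assms]) auto
  ultimately have "k \<in> ?F ?M" by blast
  then show "k \<in> ?M" by (subst gsem_MMu_unfold[OF assms])
qed

lemma gsem_cong_fv:
  "(\<And>X. X \<in> mf_fv s \<Longrightarrow> W X = W' X) \<Longrightarrow> gsem t nx W s = gsem t nx W' s"
proof (induction s arbitrary: W W')
  case (MMu X s)
  have "gsem t nx (W(X := I)) s = gsem t nx (W'(X := I)) s" for I
    by (rule MMu.IH) (use MMu.prems in auto)
  then show ?case by simp
next
  case (MOr s1 s2)
  have "gsem t nx W s1 = gsem t nx W' s1" by (rule MOr.IH) (use MOr.prems in auto)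
  moreover have "gsem t nx W s2 = gsem t nx W' s2" by (rule MOr.IH) (use MOr.prems in auto)
  ultimately show ?case by simp
next
  case (MNot s)
  have "gsem t nx W s = gsem t nx W' s" by (rule MNot.IH) (use MNot.prems in auto)
  then show ?case by simp
next
  case (MNext l s)
  have "gsem t nx W s = gsem t nx W' s" by (rule MNext.IH) (use MNext.prems in auto)
  then show ?case by simp
qed auto

text \<open>Truth is invariant under functional bisimulations \<open>f\<close>. The delicate
  inclusion for fixpoints has to carry a prefixed point forward along \<open>f\<close>.\<close>

lemma gsem_preimage:
  assumes "mf_wf s"
    and "\<And>d p u. d \<in> mf_tests s \<Longrightarrow> p \<in> mf_tvars s \<Longrightarrow> t' d p u = t d p (f u)"
    and "\<And>l u. l \<in> mf_labels s \<Longrightarrow> f (nx' l u) = nx l (f u)"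
  shows "f -` gsem t nx W s = gsem t' nx' (\<lambda>X. f -` W X) s"
  using assms
proof (induction s arbitrary: W)
  case (MMu X s)
  let ?M = "gsem t nx W (MMu X s)" and ?M' = "gsem t' nx' (\<lambda>X. f -` W X) (MMu X s)"
  have pol: "mf_pol X True s" using MMu.prems by simp
  have IH: "f -` gsem t nx (W(X := I)) s = gsem t' nx' ((\<lambda>X. f -` W X)(X := f -` I)) s" for I
  proof -
    have "(\<lambda>Y. f -` (W(X := I)) Y) = (\<lambda>X. f -` W X)(X := f -` I)"
      by (simp add: fun_eq_iff)
    moreover have "f -` gsem t nx (W(X := I)) s = gsem t' nx' (\<lambda>Y. f -` (W(X := I)) Y) s"
      by (rule MMu.IH) (use MMu.prems in auto)
    ultimately show ?thesis by simp
  qed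
  show ?case
  proof
    show "?M' \<subseteq> f -` ?M"
      by (rule gsem_MMu_lowerbound)
        (simp only: IH[of ?M, symmetric] gsem_MMu_unfold[OF pol, of t nx W, symmetric] subset_refl)
    show "f -` ?M \<subseteq> ?M'"
    proof -
      \<comment> \<open>This is the largest set whose preimage lies in \<open>?M'\<close>; it turns
        out to be a prefixed point, hence contains \<open>?M\<close>.\<close>
      have "f -` {v. \<forall>u. f u = v \<longrightarrow> u \<in> ?M'} \<subseteq> ?M'" (is "f -` ?I \<subseteq> _")
        by blast
      then have "gsem t' nx' ((\<lambda>X. f -` W X)(X := f -` ?I)) s \<subseteq> ?M'"
        by (subst gsem_MMu_unfold[OF pol]) (rule gsem_mono[OF pol])
      then have "f -` gsem t nx (W(X := ?I)) s \<subseteq> ?M'"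
        unfolding IH .
      then have "?M \<subseteq> ?I"
        by (intro gsem_MMu_lowerbound) blast
      then show ?thesis by blast
    qed
  qed
next
  case (MOr s1 s2)
  have "f -` gsem t nx W s1 = gsem t' nx' (\<lambda>X. f -` W X) s1"
    by (rule MOr.IH) (use MOr.prems in auto)
  moreover have "f -` gsem t nx W s2 = gsem t' nx' (\<lambda>X. f -` W X) s2"
    by (rule MOr.IH) (use MOr.prems in auto)
  ultimately show ?case by auto
next
  case (MNot s)
  have "f -` gsem t nx W s = gsem t' nx' (\<lambda>X. f -` W X) s"
    by (rule MNot.IH) (use MNot.prems in auto)
  then show ?case by auto
next
  case (MNext l s)
  have "f -` gsem t nx W s = gsem t' nx' (\<lambda>X. f -` W X) s"
    by (rule MNext.IH) (use MNext.prems in auto)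
  then have "f v \<in> gsem t nx W s \<longleftrightarrow> v \<in> gsem t' nx' (\<lambda>X. f -` W X) s" for v by blast
  then show ?case using MNext.prems(3)[of l] by (simp add: set_eq_iff flip: MNext.prems(3))
qed auto

text \<open>Over a word, formulae look only forward: shifting by \<open>k\<close> is a bisimulation,
  and after the shift the two valuations coincide on the free variables.\<close>

lemma gsem_word_agree_above:
  assumes "mf_wf s" "k \<le> j" and "\<And>X i. X \<in> mf_fv s \<Longrightarrow> k \<le> i \<Longrightarrow> i \<in> W X \<longleftrightarrow> i \<in> W' X"
  shows "j \<in> gsem t (\<lambda>_. Suc) W s \<longleftrightarrow> j \<in> gsem t (\<lambda>_. Suc) W' s"
proof -
  let ?f = "\<lambda>i. i + k"
  have pre: "?f -` gsem t (\<lambda>_. Suc) V s = gsem (\<lambda>d p i. t d p (?f i)) (\<lambda>_. Suc) (\<lambda>X. ?f -` V X) s" for V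
    by (rule gsem_preimage) (use assms in auto)
  have "gsem (\<lambda>d p i. t d p (?f i)) (\<lambda>_. Suc) (\<lambda>X. ?f -` W X) s
      = gsem (\<lambda>d p i. t d p (?f i)) (\<lambda>_. Suc) (\<lambda>X. ?f -` W' X) s"
    by (rule gsem_cong_fv) (use assms(3) in auto)
  then have "?f -` gsem t (\<lambda>_. Suc) W s = ?f -` gsem t (\<lambda>_. Suc) W' s"
    unfolding pre .
  then have "j - k \<in> ?f -` gsem t (\<lambda>_. Suc) W s \<longleftrightarrow> j - k \<in> ?f -` gsem t (\<lambda>_. Suc) W' s" by simp
  then show ?thesis using assms(2) by simp
qed

text \<open>With a single label the visited vectors are the iterates of one step function, so
  mapping \<open>k\<close> to the \<open>k\<close>-th vector is a functional bisimulation from the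
  word.\<close>

lemma msem_along_path:
  assumes "mf_wf s" "mf_fv s = {}" "mf_labels s \<subseteq> {l}"
    and "\<And>d p k. d \<in> mf_tests s \<Longrightarrow> p \<in> mf_tvars s \<Longrightarrow>
           t d p k \<longleftrightarrow> (st l Pi ^^ k) (\<lambda>_. 0) p \<in> tsem0 (Pi p) d"
  shows "(\<lambda>_. 0) \<in> msem st Pi (\<lambda>_. {}) s \<longleftrightarrow> 0 \<in> gsem t (\<lambda>_. Suc) (\<lambda>_. {}) s"
proof -
  let ?f = "\<lambda>k. (st l Pi ^^ k) (\<lambda>_. 0)"
  have "?f -` msem st Pi (\<lambda>_. {}) s = gsem t (\<lambda>_. Suc) (\<lambda>X. ?f -` {}) s"
    unfolding msem_eq_gsem by (rule gsem_preimage) (use assms in auto)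
  then have "0 \<in> ?f -` msem st Pi (\<lambda>_. {}) s \<longleftrightarrow> 0 \<in> gsem t (\<lambda>_. Suc) (\<lambda>_. {}) s" by simp
  then show ?thesis by simp
qed

section \<open>Finitely many types of suffixes\<close>

text \<open>The type records the tests and variables at \<open>k\<close> and the truth at
  \<open>Suc k\<close> of every argument of a next operator, bound variables being read as their
  fixpoints. Lists of fixed length leave finitely many types, and the type of a disjunction splits
  uniquely into its parts.\<close>

primrec suffix_type :: "('a tf \<Rightarrow> nat \<Rightarrow> nat \<Rightarrow> bool) \<Rightarrow> (nat \<Rightarrow> nat set) \<Rightarrow> ('a, 'n) mf
    \<Rightarrow> nat \<Rightarrow> bool list" where
  "suffix_type t W (MTest d p) k = [t d p k]"
| "suffix_type t W (MVar X) k = [k \<in> W X]"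
| "suffix_type t W (MOr s1 s2) k = suffix_type t W s1 k @ suffix_type t W s2 k"
| "suffix_type t W (MNot s) k = suffix_type t W s k"
| "suffix_type t W (MNext l s) k = (Suc k \<in> gsem t (\<lambda>_. Suc) W s) # suffix_type t W s k"
| "suffix_type t W (MMu X s) k = suffix_type t (W(X := gsem t (\<lambda>_. Suc) W (MMu X s))) s k"

primrec suffix_type_length :: "('a, 'n) mf \<Rightarrow> nat" where
  "suffix_type_length (MTest d p) = 1"
| "suffix_type_length (MVar X) = 1"
| "suffix_type_length (MOr s1 s2) = suffix_type_length s1 + suffix_type_length s2"
| "suffix_type_length (MNot s) = suffix_type_length s"
| "suffix_type_length (MNext l s) = Suc (suffix_type_length s)"
| "suffix_type_length (MMu X s) = suffix_type_length s"

lemma length_suffix_type: "length (suffix_type t W s k) = suffix_type_length s"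
  by (induction s arbitrary: W) auto

lemma suffix_type_imp_sat:
  assumes "mf_wf s" "suffix_type t W s k = suffix_type t' W' s k'"
  shows "k \<in> gsem t (\<lambda>_. Suc) W s \<longleftrightarrow> k' \<in> gsem t' (\<lambda>_. Suc) W' s"
  using assms
proof (induction s arbitrary: W W')
  case (MOr s1 s2)
  then show ?case by (simp add: length_suffix_type)
next
  case (MMu X s)
  have pol: "mf_pol X True s" and wf: "mf_wf s" using MMu.prems by auto
  show ?case
    by (subst (1 2) gsem_MMu_unfold[OF pol], rule MMu.IH[OF wf])
      (use MMu.prems(2) in \<open>simp only: suffix_type.simps\<close>)
qed auto

text \<open>This will make the removal of \<open>k\<close> from a fixpoint invisible to the type at
  \<open>Suc k\<close>.\<close>

lemma suffix_type_agree_above: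
  assumes "mf_wf s" "\<And>X i. X \<in> mf_fv s \<Longrightarrow> k \<le> i \<Longrightarrow> i \<in> W X \<longleftrightarrow> i \<in> W' X"
  shows "suffix_type t W s k = suffix_type t W' s k"
  using assms
proof (induction s arbitrary: W W')
  case (MNext l s)
  have "Suc k \<in> gsem t (\<lambda>_. Suc) W s \<longleftrightarrow> Suc k \<in> gsem t (\<lambda>_. Suc) W' s"
    by (rule gsem_word_agree_above[of s k]) (use MNext.prems in auto)
  moreover have "suffix_type t W s k = suffix_type t W' s k"
    by (rule MNext.IH) (use MNext.prems in auto)
  ultimately show ?case by simp
next
  case (MOr s1 s2)
  have "suffix_type t W s1 k = suffix_type t W' s1 k"
    by (rule MOr.IH) (use MOr.prems in auto)
  moreover have "suffix_type t W s2 k = suffix_type t W' s2 k"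
    by (rule MOr.IH) (use MOr.prems in auto)
  ultimately show ?case by simp
next
  case (MNot s)
  have "suffix_type t W s k = suffix_type t W' s k"
    by (rule MNot.IH) (use MNot.prems in auto)
  then show ?case by simp
next
  case (MMu X s)
  let ?M = "gsem t (\<lambda>_. Suc) W (MMu X s)" and ?M' = "gsem t (\<lambda>_. Suc) W' (MMu X s)"
  have M: "i \<in> ?M \<longleftrightarrow> i \<in> ?M'" if "k \<le> i" for i
    by (rule gsem_word_agree_above[OF MMu.prems(1) that MMu.prems(2)])
  have wf: "mf_wf s" using MMu.prems(1) by simp
  have "suffix_type t (W(X := ?M)) s k = suffix_type t (W'(X := ?M')) s k"
  proof (rule MMu.IH[OF wf])
    fix Y i assume "Y \<in> mf_fv s" "k \<le> i"
    then show "i \<in> (W(X := ?M)) Y \<longleftrightarrow> i \<in> (W'(X := ?M')) Y"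
      using M MMu.prems(2)[of Y i] by (cases "Y = X") (simp_all del: gsem.simps)
  qed
  then show ?case by (simp only: suffix_type.simps)
qed auto

text \<open>The congruence property behind pumping: the current letter and the next type determine
  the current type. Fixpoints look circular, as the type at \<open>k\<close> may record whether
  \<open>k\<close> itself lies in the fixpoint.\<close>

lemma suffix_type_Cons:
  assumes "mf_wf s"
    and "\<And>d p. d \<in> mf_tests s \<Longrightarrow> p \<in> mf_tvars s \<Longrightarrow> t d p k = t' d p k'"
    and "\<And>X. X \<in> mf_fv s \<Longrightarrow> k \<in> W X \<longleftrightarrow> k' \<in> W' X"
    and "suffix_type t W s (Suc k) = suffix_type t' W' s (Suc k')"
  shows "suffix_type t W s k = suffix_type t' W' s k'"
  using assms
proof (induction s arbitrary: W W')
  case (MOr s1 s2)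
  then show ?case by (simp add: length_suffix_type)
next
  case (MNext l s)
  have "suffix_type t W s k = suffix_type t' W' s k'"
    by (rule MNext.IH) (use MNext.prems in auto)
  moreover have "Suc k \<in> gsem t (\<lambda>_. Suc) W s \<longleftrightarrow> Suc k' \<in> gsem t' (\<lambda>_. Suc) W' s"
    by (rule suffix_type_imp_sat) (use MNext.prems in auto)
  ultimately show ?case by simp
next
  case (MMu X s)
  let ?M = "gsem t (\<lambda>_. Suc) W (MMu X s)" and ?M' = "gsem t' (\<lambda>_. Suc) W' (MMu X s)"
  have wf: "mf_wf s" and pol: "mf_pol X True s" using MMu.prems by auto
  have eq: "suffix_type t (W(X := ?M)) s (Suc k) = suffix_type t' (W'(X := ?M')) s (Suc k')"
    using MMu.prems(4) by (simp only: suffix_type.simps)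
  \<comment> \<open>Removing \<open>k\<close> and \<open>k'\<close> makes the variable false at both
    points and leaves the types one step later unchanged. The induction hypothesis then settles
    membership of \<open>k\<close> and \<open>k'\<close>, and is applied again to the full
    fixpoints.\<close>
  have "suffix_type t (W(X := ?M - {k})) s (Suc k) = suffix_type t (W(X := ?M)) s (Suc k)"
    by (rule suffix_type_agree_above[OF wf]) (simp del: gsem.simps)
  moreover have "suffix_type t' (W'(X := ?M' - {k'})) s (Suc k') = suffix_type t' (W'(X := ?M')) s (Suc k')"
    by (rule suffix_type_agree_above[OF wf]) (simp del: gsem.simps)
  ultimately have eq': "suffix_type t (W(X := ?M - {k})) s (Suc k)
      = suffix_type t' (W'(X := ?M' - {k'})) s (Suc k')"
    using eq by argo
  have "suffix_type t (W(X := ?M - {k})) s k = suffix_type t' (W'(X := ?M' - {k'})) s k'"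
    by (rule MMu.IH[OF wf _ _ eq']) (use MMu.prems(2,3) in \<open>simp_all del: gsem.simps\<close>)
  note sat = suffix_type_imp_sat[OF wf this]
  have "k \<in> ?M \<longleftrightarrow> k' \<in> ?M'"
    by (rule trans[OF mem_gsem_MMu_iff[OF pol] trans[OF sat mem_gsem_MMu_iff[OF pol, symmetric]]])
  then have "suffix_type t (W(X := ?M)) s k = suffix_type t' (W'(X := ?M')) s k'"
    by (intro MMu.IH[OF wf _ _ eq]) (use MMu.prems(2,3) in \<open>simp_all del: gsem.simps\<close>)
  then show ?case by (simp only: suffix_type.simps)
qed auto

text \<open>\<open>suffix_type_Cons\<close> is iterated backwards through the common prefix.\<close>

lemma suffix_type_append:
  assumes "mf_wf s" "mf_fv s = {}"
    and "\<And>d p i. d \<in> mf_tests s \<Longrightarrow> p \<in> mf_tvars s \<Longrightarrow> i < n \<Longrightarrow> t d p i = t' d p i"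
    and "suffix_type t W s n = suffix_type t' W' s n"
  shows "suffix_type t W s 0 = suffix_type t' W' s 0"
  using assms(3,4)
proof (induction n)
  case (Suc n)
  have "suffix_type t W s n = suffix_type t' W' s n"
    by (rule suffix_type_Cons) (use assms Suc.prems in auto)
  with Suc show ?case by simp
qed

lemma suffix_type_shift:
  assumes "mf_wf s"
    and "\<And>d p i. d \<in> mf_tests s \<Longrightarrow> p \<in> mf_tvars s \<Longrightarrow> t' d p i = t d p (n + i)"
  shows "suffix_type t W s (n + i) = suffix_type t' (\<lambda>X. (+) n -` W X) s i"
proof -
  \<comment> \<open>Both statements range over all \<open>r\<close> built from tests and trace
    variables of \<open>s\<close>, so that the hypothesis on tests stays fixed during the
    induction.\<close>
  have pre: "(+) n -` gsem t (\<lambda>_. Suc) V r = gsem t' (\<lambda>_. Suc) (\<lambda>X. (+) n -` V X) r"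
    if "mf_wf r" "mf_tests r \<subseteq> mf_tests s" "mf_tvars r \<subseteq> mf_tvars s" for V and r :: "('a, 'b) mf"
    by (rule gsem_preimage) (use assms(2) that in \<open>simp_all add: subset_iff\<close>)
  have "suffix_type t V r (n + i) = suffix_type t' (\<lambda>X. (+) n -` V X) r i"
    if "mf_wf r" "mf_tests r \<subseteq> mf_tests s" "mf_tvars r \<subseteq> mf_tvars s" for V and r :: "('a, 'b) mf"
    using that
  proof (induction r arbitrary: V)
    case (MNext l r)
    have r: "mf_wf r" "mf_tests r \<subseteq> mf_tests s" "mf_tvars r \<subseteq> mf_tvars s"
      using MNext.prems by auto
    have "Suc i \<in> (+) n -` gsem t (\<lambda>_. Suc) V r \<longleftrightarrow> Suc i \<in> gsem t' (\<lambda>_. Suc) (\<lambda>X. (+) n -` V X) r"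
      by (simp only: pre[OF r])
    then show ?case using MNext.IH[OF r] by simp
  next
    case (MMu X r)
    have "(\<lambda>Y. (+) n -` (V(X := gsem t (\<lambda>_. Suc) V (MMu X r))) Y)
      = (\<lambda>X. (+) n -` V X)(X := gsem t' (\<lambda>_. Suc) (\<lambda>X. (+) n -` V X) (MMu X r))"
      using pre[OF MMu.prems, of V] by (simp add: fun_eq_iff del: gsem.simps)
    moreover have "suffix_type t (V(X := gsem t (\<lambda>_. Suc) V (MMu X r))) r (n + i)
      = suffix_type t' (\<lambda>Y. (+) n -` (V(X := gsem t (\<lambda>_. Suc) V (MMu X r))) Y) r i"
      by (rule MMu.IH) (use MMu.prems in auto)
    ultimately show ?case by (simp only: suffix_type.simps(6))
  next
    case (MTest d p)
    then show ?case using assms(2)[of d p i] by simp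
  qed auto
  then show ?thesis using assms(1) by blast
qed

section \<open>LTL formulae\<close>

lemma tsem_cong_fv:
  "(\<And>Y. Y \<in> tf_fv d \<Longrightarrow> V Y = V' Y) \<Longrightarrow> tsem tr V d = tsem tr V' d"
proof (induction d arbitrary: V V')
  case (TOr d1 d2)
  have "tsem tr V d1 = tsem tr V' d1" by (rule TOr.IH) (use TOr.prems in auto)
  moreover have "tsem tr V d2 = tsem tr V' d2" by (rule TOr.IH) (use TOr.prems in auto)
  ultimately show ?case by simp
next
  case (TNot d)
  have "tsem tr V d = tsem tr V' d" by (rule TNot.IH) (use TNot.prems in auto)
  then show ?case by simp
next
  case (TNext f d)
  have "tsem tr V d = tsem tr V' d" by (rule TNext.IH) (use TNext.prems in auto)
  then show ?case by simp
next
  case (TMu Y d)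
  have "tsem tr (V(Y := I)) d = tsem tr (V'(Y := I)) d" for I
    by (rule TMu.IH) (use TMu.prems in auto)
  then show ?case by simp
qed auto

lemma tf_pol_not_free: "Y \<notin> tf_fv d \<Longrightarrow> tf_pol Y p d"
  by (induction d arbitrary: p) auto

lemma is_ltl_closed_wf:
  assumes "is_ltl d"
  shows "tf_closed_wf d"
proof -
  from assms have "tf_fv d = {} \<and> tf_wf d"
    by induction (auto simp: TUntil_def TAnd_def tf_pol_not_free)
  then show ?thesis by (simp add: tf_closed_wf_def)
qed

lemma tsem_closed: "tf_closed_wf d \<Longrightarrow> tsem tr V d = tsem0 tr d"
  unfolding tsem0_def by (rule tsem_cong_fv) (simp add: tf_closed_wf_def)

lemma is_ltl_TAnd: "is_ltl d \<Longrightarrow> is_ltl e \<Longrightarrow> is_ltl (TAnd d e)"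
  unfolding TAnd_def by (intro is_ltl.intros)

lemma tsem0_simps:
  "i \<in> tsem0 tr (TAP p) \<longleftrightarrow> p \<in> fst (tr i)"
  "i \<in> tsem0 tr (TNot d) \<longleftrightarrow> i \<notin> tsem0 tr d"
  "i \<in> tsem0 tr (TOr d e) \<longleftrightarrow> i \<in> tsem0 tr d \<or> i \<in> tsem0 tr e"
  "i \<in> tsem0 tr (TAnd d e) \<longleftrightarrow> i \<in> tsem0 tr d \<and> i \<in> tsem0 tr e"
  "i \<in> tsem0 tr (TNext SG d) \<longleftrightarrow> Suc i \<in> tsem0 tr d"
  by (auto simp: tsem0_def TAnd_def)

text \<open>The arguments are closed and ignore the value of \<open>Y\<close>, so the body becomes a
  concrete operator whose least prefixed point can be computed directly.\<close>

lemma tsem0_TUntil_iff: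
  assumes "is_ltl d1" "is_ltl d2"
  shows "i \<in> tsem0 tr (TUntil Y d1 d2) \<longleftrightarrow>
    (\<exists>k\<ge>i. k \<in> tsem0 tr d2 \<and> (\<forall>j. i \<le> j \<and> j < k \<longrightarrow> j \<in> tsem0 tr d1))"
proof -
  note closed = assms[THEN is_ltl_closed_wf, THEN tsem_closed]
  let ?U = "{i. \<exists>k\<ge>i. k \<in> tsem0 tr d2 \<and> (\<forall>j. i \<le> j \<and> j < k \<longrightarrow> j \<in> tsem0 tr d1)}"
  let ?P = "\<lambda>I. tsem0 tr d2 \<union> (tsem0 tr d1 \<inter> {i. Suc i \<in> I}) \<subseteq> I"
  have "?P ?U"
  proof (intro subsetI CollectI)
    fix i assume "i \<in> tsem0 tr d2 \<union> (tsem0 tr d1 \<inter> {i. Suc i \<in> ?U})"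
    then show "\<exists>k\<ge>i. k \<in> tsem0 tr d2 \<and> (\<forall>j. i \<le> j \<and> j < k \<longrightarrow> j \<in> tsem0 tr d1)"
    proof
      assume "i \<in> tsem0 tr d1 \<inter> {i. Suc i \<in> ?U}"
      then obtain k where "i \<in> tsem0 tr d1" "Suc i \<le> k" "k \<in> tsem0 tr d2"
        "\<And>j. Suc i \<le> j \<Longrightarrow> j < k \<Longrightarrow> j \<in> tsem0 tr d1" by auto
      moreover from this have "j \<in> tsem0 tr d1" if "i \<le> j" "j < k" for j
        using that by (cases "j = i") auto
      ultimately show ?thesis by (intro exI[of _ k]) auto
    qed auto
  qed
  moreover have "?U \<subseteq> I" if I: "?P I" for I
  proof
    fix i assume "i \<in> ?U"
    then obtain k where "i \<le> k" "k \<in> tsem0 tr d2" "\<forall>j. i \<le> j \<and> j < k \<longrightarrow> j \<in> tsem0 tr d1"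
      by auto
    then show "i \<in> I" by (induction rule: inc_induct) (use I in auto)
  qed
  ultimately have "\<Inter> {I. ?P I} = ?U" by blast
  moreover have "tsem tr V (TUntil Y d1 d2) = \<Inter> {I. ?P I}" for V
    by (simp add: TUntil_def TAnd_def closed)
  then have "tsem0 tr (TUntil Y d1 d2) = \<Inter> {I. ?P I}"
    unfolding tsem0_def[of tr "TUntil Y d1 d2"] .
  ultimately show ?thesis by auto
qed

lemma tsem0_TUntil_unfold:
  assumes "is_ltl d1" "is_ltl d2"
  shows "i \<in> tsem0 tr (TUntil Y d1 d2) \<longleftrightarrow>
    i \<in> tsem0 tr d2 \<or> i \<in> tsem0 tr d1 \<and> Suc i \<in> tsem0 tr (TUntil Y d1 d2)"
    (is "?U i \<longleftrightarrow> ?d2 \<or> ?d1 \<and> ?U (Suc i)")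
proof
  assume "?U i"
  then obtain k where k: "i \<le> k" "k \<in> tsem0 tr d2" "\<And>j. i \<le> j \<Longrightarrow> j < k \<Longrightarrow> j \<in> tsem0 tr d1"
    unfolding tsem0_TUntil_iff[OF assms] by blast
  show "?d2 \<or> ?d1 \<and> ?U (Suc i)"
  proof (cases "k = i")
    case False
    with k show ?thesis unfolding tsem0_TUntil_iff[OF assms] by (auto intro!: exI[of _ k])
  qed (use k in auto)
next
  assume "?d2 \<or> ?d1 \<and> ?U (Suc i)"
  then show "?U i"
  proof
    assume "?d1 \<and> ?U (Suc i)"
    then obtain k where k: "i \<in> tsem0 tr d1" "Suc i \<le> k" "k \<in> tsem0 tr d2"
      "\<And>j. Suc i \<le> j \<Longrightarrow> j < k \<Longrightarrow> j \<in> tsem0 tr d1"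
      unfolding tsem0_TUntil_iff[OF assms] by blast
    then have "j \<in> tsem0 tr d1" if "i \<le> j" "j < k" for j
      using that by (cases "j = i") auto
    with k show "?U i" unfolding tsem0_TUntil_iff[OF assms] by (auto intro!: exI[of _ k])
  qed (auto simp: tsem0_TUntil_iff[OF assms])
qed

text \<open>Here and below, \<open>undefined\<close> serves as a fixed but arbitrary atomic
  proposition; it is the letter \<open>a\<close> of the overview.\<close>

definition TTrue :: "'a tf" where
  "TTrue = TOr (TAP undefined) (TNot (TAP undefined))"

lemma is_ltl_TTrue: "is_ltl TTrue"
  unfolding TTrue_def by (intro is_ltl.intros)

lemma mem_tsem0_TTrue: "i \<in> tsem0 tr TTrue"
  by (simp add: TTrue_def tsem0_simps)

section \<open>Simulating stuttering by mumbling\<close>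

definition TXor :: "'a tf \<Rightarrow> 'a tf \<Rightarrow> 'a tf" where
  "TXor d e = TOr (TAnd d (TNot e)) (TAnd (TNot d) e)"

definition change_list :: "'a tf list \<Rightarrow> 'a tf" where
  "change_list ds = foldr (\<lambda>d. TOr (TXor d (TNext SG d))) ds (TNot TTrue)"

text \<open>The order in which the finite set is listed does not affect the meaning, hence the
  arbitrary choice.\<close>

definition change_formula :: "'a tf set \<Rightarrow> 'a tf" where
  "change_formula g = change_list (SOME ds. set ds = g)"

lemma is_ltl_change_formula:
  assumes "finite g" "\<forall>d\<in>g. is_ltl d"
  shows "is_ltl (change_formula g)"
proof -
  have "\<forall>d\<in>set ds. is_ltl d \<Longrightarrow> is_ltl (change_list ds)" for ds :: "'a tf list"
    by (induction ds)
      (auto simp: change_list_def TXor_def is_ltl_TTrue is_ltl_TAnd is_ltl.intros)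
  with assms show ?thesis
    unfolding change_formula_def by (metis (mono_tags, lifting) finite_list someI_ex)
qed

lemma tsem0_change_formula:
  assumes "finite g"
  shows "i \<in> tsem0 tr (change_formula g) \<longleftrightarrow> (\<exists>d\<in>g. (i \<in> tsem0 tr d) \<noteq> (Suc i \<in> tsem0 tr d))"
proof -
  have "i \<in> tsem0 tr (change_list ds) \<longleftrightarrow> (\<exists>d\<in>set ds. (i \<in> tsem0 tr d) \<noteq> (Suc i \<in> tsem0 tr d))"
    for ds :: "'a tf list"
    by (induction ds) (auto simp: change_list_def TXor_def tsem0_simps mem_tsem0_TTrue)
  moreover have "set (SOME ds. set ds = g) = g"
    using finite_list[OF assms] by (rule someI_ex)
  ultimately show ?thesis unfolding change_formula_def by simp
qed

text \<open>The first position that differs from \<open>i\<close> lies just past the first change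
  between neighbours. The search for a change starts at \<open>i\<close> itself, whereas
  \<open>succ_delta\<close> starts after its argument.\<close>

lemma succ_gamma_eq_Least_change:
  fixes tr :: "'a trace"
  assumes "finite g"
  defines "C \<equiv> tsem0 tr (change_formula g)"
  shows "succ_gamma g tr i = (if \<exists>j\<ge>i. j \<in> C then Suc (LEAST j. i \<le> j \<and> j \<in> C) else Suc i)"
proof -
  define R where "R = (\<lambda>i j. \<exists>d\<in>g. (i \<in> tsem0 tr d) \<noteq> (j \<in> tsem0 tr d))"
  have C: "j \<in> C \<longleftrightarrow> R j (Suc j)" for j
    unfolding C_def R_def by (rule tsem0_change_formula[OF assms(1)])
  have same: "\<not> R i j" if "i \<le> j" "\<And>k. i \<le> k \<Longrightarrow> k < j \<Longrightarrow> k \<notin> C" for j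
    using that
  proof (induction rule: dec_induct)
    case base
    then show ?case by (simp add: R_def)
  next
    case (step j)
    then have "\<not> R i j" "\<not> R j (Suc j)" using C by auto
    then show ?case unfolding R_def by blast
  qed
  have succ: "succ_gamma g tr i = (if \<exists>j>i. R i j then LEAST j. i < j \<and> R i j else Suc i)"
    unfolding succ_gamma_def R_def by auto
  show ?thesis
  proof (cases "\<exists>j\<ge>i. j \<in> C")
    case True
    define x where "x = (LEAST j. i \<le> j \<and> j \<in> C)"
    have x: "i \<le> x" "x \<in> C" using True unfolding x_def by (metis (mono_tags, lifting) LeastI)+
    have below: "k \<notin> C" if "i \<le> k" "k < x" for k
      using that not_less_Least unfolding x_def by blast
    have "\<not> R i x" using same[OF x(1)] below by blast
    moreover have "R x (Suc x)" using x C by blast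
    ultimately have "R i (Suc x)" unfolding R_def by blast
    moreover have "(LEAST j. i < j \<and> R i j) = Suc x"
    proof (rule Least_equality)
      fix j assume j: "i < j \<and> R i j"
      show "Suc x \<le> j"
      proof (rule ccontr)
        assume "\<not> Suc x \<le> j"
        then have "\<not> R i j" using j below by (intro same) auto
        with j show False by blast
      qed
    qed (use \<open>R i (Suc x)\<close> x in auto)
    ultimately show ?thesis using True x(1) succ unfolding x_def
      by (metis less_Suc_eq_le)
  next
    case False
    then have "\<not> R i j" if "i < j" for j using that by (intro same) auto
    with False succ show ?thesis by auto
  qed
qed

text \<open>Starting one position later turns "at or after" into "strictly after", and the default
  also moves on by one.\<close>

lemma succ_gamma_Suc:
  "finite g \<Longrightarrow> succ_gamma g tr (Suc i) = Suc (succ_delta (change_formula g) tr i)"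
  by (auto simp: succ_gamma_eq_Least_change succ_delta_def Suc_le_eq)

text \<open>For a change formula at position 0 this means that the first stuttering step leads to
  position 1: a change follows at once, or there is none and the default applies.\<close>

definition early_change :: "'a tf \<Rightarrow> 'a tf" where
  "early_change d = TOr d (TNot (TUntil 0 TTrue d))"

text \<open>Evaluates \<open>e\<close> one position after the mumbling successor for
  \<open>d\<close>; the second disjunct covers the default step when \<open>d\<close> does not hold
  again.\<close>

definition after_next :: "'a tf \<Rightarrow> 'a tf \<Rightarrow> 'a tf" where
  "after_next d e = TNext SG (TOr (TUntil 0 (TNot d) (TAnd d (TNext SG e)))
     (TAnd (TNot (TUntil 0 TTrue d)) (TNext SG e)))"

lemma is_ltl_early_change: "is_ltl d \<Longrightarrow> is_ltl (early_change d)"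
  unfolding early_change_def by (intro is_ltl.intros is_ltl_TTrue)

lemma is_ltl_after_next: "is_ltl d \<Longrightarrow> is_ltl e \<Longrightarrow> is_ltl (after_next d e)"
  unfolding after_next_def by (intro is_ltl.intros is_ltl_TTrue is_ltl_TAnd)

lemma tsem0_early_change:
  "is_ltl d \<Longrightarrow> 0 \<in> tsem0 tr (early_change d) \<longleftrightarrow> 0 \<in> tsem0 tr d \<or> tsem0 tr d = {}"
  by (auto simp: early_change_def tsem0_simps tsem0_TUntil_iff is_ltl_TTrue mem_tsem0_TTrue)

lemma tsem0_after_next:
  assumes "is_ltl d" "is_ltl e"
  shows "i \<in> tsem0 tr (after_next d e) \<longleftrightarrow> Suc (succ_delta d tr i) \<in> tsem0 tr e"
proof -
  have sem: "i \<in> tsem0 tr (after_next d e) \<longleftrightarrow>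
      (\<exists>k\<ge>Suc i. (k \<in> tsem0 tr d \<and> Suc k \<in> tsem0 tr e) \<and> (\<forall>j. Suc i \<le> j \<and> j < k \<longrightarrow> j \<notin> tsem0 tr d))
      \<or> (\<forall>k\<ge>Suc i. k \<notin> tsem0 tr d) \<and> Suc (Suc i) \<in> tsem0 tr e"
    unfolding after_next_def
    by (auto simp: tsem0_simps tsem0_TUntil_iff is_ltl_TTrue mem_tsem0_TTrue assms
        is_ltl_TAnd is_ltl.intros)
  show ?thesis
  proof (cases "\<exists>j>i. j \<in> tsem0 tr d")
    case True
    define x where "x = (LEAST j. j > i \<and> j \<in> tsem0 tr d)"
    have x: "i < x" "x \<in> tsem0 tr d"
      using True unfolding x_def by (metis (mono_tags, lifting) LeastI)+
    have below: "k \<notin> tsem0 tr d" if "i < k" "k < x" for k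
      using that not_less_Least unfolding x_def by blast
    have "succ_delta d tr i = x" using True by (auto simp: succ_delta_def x_def)
    moreover have "k = x" if "i < k" "k \<in> tsem0 tr d" "\<forall>j. i < j \<and> j < k \<longrightarrow> j \<notin> tsem0 tr d" for k
      using that x below by (metis linorder_neqE_nat)
    ultimately show ?thesis unfolding sem Suc_le_eq using x below by blast
  next
    case False
    then have "succ_delta d tr i = Suc i" by (auto simp: succ_delta_def)
    with False show ?thesis unfolding sem Suc_le_eq by auto
  qed
qed

text \<open>A change right after position 0 is missed by mumbling, which moves strictly forward: the first
  stuttering step then has no mumbling counterpart. Otherwise the mumbling path lags behind by one
  step forever, and \<open>after_next\<close> looks ahead instead.\<close>

lemma stuttering_path_eq:
  fixes tr :: "'a trace"
  assumes "finite g" "\<forall>d\<in>g. is_ltl d"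
  defines "d \<equiv> change_formula g"
  shows "(succ_gamma g tr ^^ Suc k) 0 =
    (if 0 \<in> tsem0 tr (early_change d) then Suc ((succ_delta d tr ^^ k) 0)
     else Suc (succ_delta d tr ((succ_delta d tr ^^ k) 0)))"
proof -
  have ltl: "is_ltl d" unfolding d_def by (rule is_ltl_change_formula[OF assms(1,2)])
  note early = tsem0_early_change[OF ltl, of tr]
  note least = succ_gamma_eq_Least_change[OF assms(1), of tr 0, folded d_def]
  show ?thesis
  proof (induction k)
    case 0
    show ?case
    proof (cases "0 \<in> tsem0 tr (early_change d)")
      case True
      then have "succ_gamma g tr 0 = Suc 0" unfolding early least by auto
      with True show ?thesis by simp
    next
      case False
      \<comment> \<open>Position 0 is no change here, so searching from 0 and searching strictly
        after 0 agree.\<close>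
      then have "(0 \<le> j \<and> j \<in> tsem0 tr d) = (0 < j \<and> j \<in> tsem0 tr d)" for j
        unfolding early by (cases j) auto
      moreover have "\<exists>j>0. j \<in> tsem0 tr d" "\<exists>j. j \<in> tsem0 tr d"
        using False unfolding early by (metis equals0I gr0I)+
      ultimately have "succ_gamma g tr 0 = Suc (succ_delta d tr 0)"
        unfolding least succ_delta_def by auto
      with False show ?thesis by simp
    qed
  next
    case (Suc k)
    have "(succ_gamma g tr ^^ Suc (Suc k)) 0 = succ_gamma g tr ((succ_gamma g tr ^^ Suc k) 0)"
      by simp
    then show ?case unfolding Suc.IH using succ_gamma_Suc[OF assms(1), of tr, folded d_def] by auto
  qed
qed

section \<open>Rewriting formulae for a path that lags one step behind\<close>

abbreviation (input) MAnd :: "('a, 'n) mf \<Rightarrow> ('a, 'n) mf \<Rightarrow> ('a, 'n) mf" where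
  "MAnd s1 s2 \<equiv> MNot (MOr (MNot s1) (MNot s2))"

definition MFalse :: "('a, 'n) mf" where
  "MFalse = MMu 0 (MVar 0)"

lemma gsem_MFalse: "gsem t nx W MFalse = {}"
  by (auto simp: MFalse_def)

text \<open>Since paths are strictly increasing, the first position is visited only once. So a variable
  occurring there before any next operator may be replaced by false, and all other occurrences of
  it by its (closed) defining fixpoint formula.\<close>

primrec later :: "(nat \<Rightarrow> 'a tf \<Rightarrow> 'a tf) \<Rightarrow> 'k \<Rightarrow> (nat \<Rightarrow> ('a, 'k) mf) \<Rightarrow> ('a, 'n) mf
    \<Rightarrow> ('a, 'k) mf" where
  "later \<theta> l \<rho> (MTest d p) = MTest (\<theta> p d) p"
| "later \<theta> l \<rho> (MVar X) = \<rho> X"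
| "later \<theta> l \<rho> (MOr s1 s2) = MOr (later \<theta> l \<rho> s1) (later \<theta> l \<rho> s2)"
| "later \<theta> l \<rho> (MNot s) = MNot (later \<theta> l \<rho> s)"
| "later \<theta> l \<rho> (MNext l' s) = MNext l (later \<theta> l \<rho> s)"
| "later \<theta> l \<rho> (MMu X s) = MMu X (later \<theta> l (\<rho>(X := MVar X)) s)"

primrec initial :: "(nat \<Rightarrow> 'a tf \<Rightarrow> 'a tf) \<Rightarrow> 'k \<Rightarrow> (nat \<Rightarrow> ('a, 'k) mf) \<Rightarrow> ('a, 'n) mf
    \<Rightarrow> ('a, 'k) mf" where
  "initial \<theta> l \<rho> (MTest d p) = MTest d p"
| "initial \<theta> l \<rho> (MVar X) = MFalse"
| "initial \<theta> l \<rho> (MOr s1 s2) = MOr (initial \<theta> l \<rho> s1) (initial \<theta> l \<rho> s2)"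
| "initial \<theta> l \<rho> (MNot s) = MNot (initial \<theta> l \<rho> s)"
| "initial \<theta> l \<rho> (MNext l' s) = later \<theta> l \<rho> s"
| "initial \<theta> l \<rho> (MMu X s) = initial \<theta> l (\<rho>(X := later \<theta> l \<rho> (MMu X s))) s"

lemma mf_fv_later: "mf_fv (later \<theta> l \<rho> s) \<subseteq> (\<Union>Y\<in>mf_fv s. mf_fv (\<rho> Y))"
  by (induction s arbitrary: \<rho>) (fastforce split: if_splits)+

text \<open>\<open>t\<close> belongs to the simulated path, \<open>t'\<close> to the lagging one,
  and \<open>\<theta>\<close> makes a test anticipate one step. The condition on
  \<open>\<rho>\<close> prevents capture: rebinding \<open>X\<close> affects only the image of
  \<open>X\<close>, which the fixpoint case resets to the variable.\<close>

lemma gsem_later: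
  assumes "\<And>d p k. d \<in> mf_tests s \<Longrightarrow> p \<in> mf_tvars s \<Longrightarrow> t' (\<theta> p d) p k = t d p (Suc k)"
    and "\<And>Y. mf_fv (\<rho> Y) \<subseteq> {Y}"
  shows "gsem t' (\<lambda>_. Suc) W (later \<theta> l \<rho> s)
    = gsem (\<lambda>d p k. t d p (Suc k)) (\<lambda>_. Suc) (\<lambda>X. gsem t' (\<lambda>_. Suc) W (\<rho> X)) s"
  using assms
proof (induction s arbitrary: W \<rho>)
  case (MMu X s)
  have "gsem t' (\<lambda>_. Suc) (W(X := I)) (later \<theta> l (\<rho>(X := MVar X)) s)
    = gsem (\<lambda>d p k. t d p (Suc k)) (\<lambda>_. Suc) ((\<lambda>X. gsem t' (\<lambda>_. Suc) W (\<rho> X))(X := I)) s" for I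
  proof -
    have "gsem t' (\<lambda>_. Suc) (W(X := I)) (\<rho> Y) = gsem t' (\<lambda>_. Suc) W (\<rho> Y)" if "Y \<noteq> X" for Y
      by (rule gsem_cong_fv) (use MMu.prems(2)[of Y] that in auto)
    then have "(\<lambda>Y. gsem t' (\<lambda>_. Suc) (W(X := I)) ((\<rho>(X := MVar X)) Y))
        = (\<lambda>X. gsem t' (\<lambda>_. Suc) W (\<rho> X))(X := I)"
      by (simp add: fun_eq_iff)
    moreover have "gsem t' (\<lambda>_. Suc) (W(X := I)) (later \<theta> l (\<rho>(X := MVar X)) s)
      = gsem (\<lambda>d p k. t d p (Suc k)) (\<lambda>_. Suc)
          (\<lambda>Y. gsem t' (\<lambda>_. Suc) (W(X := I)) ((\<rho>(X := MVar X)) Y)) s"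
      by (rule MMu.IH) (use MMu.prems in auto)
    ultimately show ?thesis by simp
  qed
  then show ?case by simp
qed auto

text \<open>\<open>W\<close> omits position 0 for free variables, which matches their replacement by
  \<open>MFalse\<close>; the rest of it, shifted by one, is what the closed formulae in
  \<open>\<rho>\<close> denote.\<close>

lemma gsem_initial:
  assumes "mf_wf s"
    and "\<And>d p k. d \<in> mf_tests s \<Longrightarrow> p \<in> mf_tvars s \<Longrightarrow> t' (\<theta> p d) p k = t d p (Suc k)"
    and "\<And>d p. d \<in> mf_tests s \<Longrightarrow> p \<in> mf_tvars s \<Longrightarrow> t' d p 0 = t d p 0"
    and "\<And>Y. mf_fv (\<rho> Y) = {}"
    and "\<And>X. X \<in> mf_fv s \<Longrightarrow> 0 \<notin> W X \<and> Suc -` W X = gsem t' (\<lambda>_. Suc) (\<lambda>_. {}) (\<rho> X)"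
  shows "0 \<in> gsem t' (\<lambda>_. Suc) (\<lambda>_. {}) (initial \<theta> l \<rho> s) \<longleftrightarrow> 0 \<in> gsem t (\<lambda>_. Suc) W s"
  using assms
proof (induction s arbitrary: W \<rho>)
  case (MVar X)
  then show ?case by (simp add: gsem_MFalse)
next
  case (MOr s1 s2)
  have "0 \<in> gsem t' (\<lambda>_. Suc) (\<lambda>_. {}) (initial \<theta> l \<rho> s1) \<longleftrightarrow> 0 \<in> gsem t (\<lambda>_. Suc) W s1"
    by (rule MOr.IH) (use MOr.prems in auto)
  moreover have "0 \<in> gsem t' (\<lambda>_. Suc) (\<lambda>_. {}) (initial \<theta> l \<rho> s2) \<longleftrightarrow> 0 \<in> gsem t (\<lambda>_. Suc) W s2"
    by (rule MOr.IH) (use MOr.prems in auto)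
  ultimately show ?case by simp
next
  case (MNot s)
  have "0 \<in> gsem t' (\<lambda>_. Suc) (\<lambda>_. {}) (initial \<theta> l \<rho> s) \<longleftrightarrow> 0 \<in> gsem t (\<lambda>_. Suc) W s"
    by (rule MNot.IH) (use MNot.prems in auto)
  then show ?case by simp
next
  case (MNext l' s)
  have "gsem t' (\<lambda>_. Suc) (\<lambda>_. {}) (later \<theta> l \<rho> s)
    = gsem (\<lambda>d p k. t d p (Suc k)) (\<lambda>_. Suc) (\<lambda>X. gsem t' (\<lambda>_. Suc) (\<lambda>_. {}) (\<rho> X)) s"
    by (rule gsem_later) (use MNext.prems in auto)
  also have "\<dots> = gsem (\<lambda>d p k. t d p (Suc k)) (\<lambda>_. Suc) (\<lambda>X. Suc -` W X) s"
    by (rule gsem_cong_fv) (use MNext.prems in auto)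
  also have "\<dots> = Suc -` gsem t (\<lambda>_. Suc) W s"
    by (rule gsem_preimage[symmetric]) (use MNext.prems in auto)
  finally show ?case by auto
next
  case (MMu X s)
  let ?M = "gsem t (\<lambda>_. Suc) W (MMu X s)"
  have wf: "mf_wf s" and pol: "mf_pol X True s" using MMu.prems(1) by auto
  have "gsem t' (\<lambda>_. Suc) (\<lambda>_. {}) (later \<theta> l \<rho> (MMu X s))
    = gsem (\<lambda>d p k. t d p (Suc k)) (\<lambda>_. Suc) (\<lambda>X. gsem t' (\<lambda>_. Suc) (\<lambda>_. {}) (\<rho> X)) (MMu X s)"
    by (rule gsem_later) (use MMu.prems(2,4) in auto)
  also have "\<dots> = gsem (\<lambda>d p k. t d p (Suc k)) (\<lambda>_. Suc) (\<lambda>X. Suc -` W X) (MMu X s)"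
    by (rule gsem_cong_fv) (use MMu.prems(5) in auto)
  also have "\<dots> = Suc -` ?M"
    by (rule gsem_preimage[symmetric]) (use MMu.prems(1) in auto)
  \<comment> \<open>\<open>Suc\<close> never hits 0, so dropping 0 is harmless and gives the set
    that \<open>mem_gsem_MMu_iff\<close> works with.\<close>
  finally have later: "gsem t' (\<lambda>_. Suc) (\<lambda>_. {}) (later \<theta> l \<rho> (MMu X s)) = Suc -` (?M - {0})"
    by blast
  have closed: "mf_fv (later \<theta> l \<rho> (MMu X s)) = {}"
    using mf_fv_later[of \<theta> l \<rho> "MMu X s"] MMu.prems(4) by blast
  have "0 \<in> gsem t' (\<lambda>_. Suc) (\<lambda>_. {}) (initial \<theta> l (\<rho>(X := later \<theta> l \<rho> (MMu X s))) s)
    \<longleftrightarrow> 0 \<in> gsem t (\<lambda>_. Suc) (W(X := ?M - {0})) s"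
  proof (rule MMu.IH[OF wf])
    fix Y
    show "mf_fv ((\<rho>(X := later \<theta> l \<rho> (MMu X s))) Y) = {}"
      using closed MMu.prems(4) by (simp del: later.simps)
    show "0 \<notin> (W(X := ?M - {0})) Y \<and> Suc -` (W(X := ?M - {0})) Y
        = gsem t' (\<lambda>_. Suc) (\<lambda>_. {}) ((\<rho>(X := later \<theta> l \<rho> (MMu X s))) Y)" if "Y \<in> mf_fv s"
      using that later MMu.prems(5)[of Y] by (cases "Y = X") (simp_all del: later.simps gsem.simps)
  qed (use MMu.prems(2,3) in auto)
  then show ?case unfolding initial.simps(6) by (rule trans[OF _ mem_gsem_MMu_iff[OF pol, symmetric]])
qed auto

section \<open>Syntactic conditions on translated formulae\<close>

definition admissible :: "nat set \<Rightarrow> 'k \<Rightarrow> ('a, 'k) mf \<Rightarrow> bool" where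
  "admissible P l s \<longleftrightarrow> mf_wf s \<and> mf_tvars s \<subseteq> P \<and> mf_labels s \<subseteq> {l} \<and> (\<forall>d\<in>mf_tests s. is_ltl d)"

lemma admissible_simps:
  "admissible P l (MTest d p) \<longleftrightarrow> p \<in> P \<and> is_ltl d"
  "admissible P l (MVar X)"
  "admissible P l MFalse"
  "admissible P l (MOr s1 s2) \<longleftrightarrow> admissible P l s1 \<and> admissible P l s2"
  "admissible P l (MNot s) \<longleftrightarrow> admissible P l s"
  "admissible P l (MNext l' s) \<longleftrightarrow> l' = l \<and> admissible P l s"
  "admissible P l (MMu X s) \<longleftrightarrow> mf_pol X True s \<and> admissible P l s"
  by (auto simp: admissible_def MFalse_def)

lemma mf_pol_not_free: "X \<notin> mf_fv s \<Longrightarrow> mf_pol X b s"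
  by (induction s arbitrary: b) auto

text \<open>Formulae substituted for other variables do not contain \<open>X\<close> free, so no new
  occurrences of \<open>X\<close> arise.\<close>

lemma mf_pol_later:
  assumes "mf_pol X b s" "\<rho> X = MVar X" "\<And>Y. mf_fv (\<rho> Y) \<subseteq> {Y}"
  shows "mf_pol X b (later \<theta> l \<rho> s)"
  using assms
proof (induction s arbitrary: b \<rho>)
  case (MVar Y)
  then show ?case by (cases "Y = X") (auto intro!: mf_pol_not_free)
next
  case (MMu Z s)
  then show ?case by (cases "Z = X") (auto intro!: MMu.IH)
qed auto

lemma admissible_later:
  assumes "mf_wf s" "mf_tvars s \<subseteq> P"
    and "\<And>d p. d \<in> mf_tests s \<Longrightarrow> p \<in> mf_tvars s \<Longrightarrow> is_ltl (\<theta> p d)"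
    and "\<And>Y. mf_fv (\<rho> Y) \<subseteq> {Y}" "\<And>Y. admissible P l (\<rho> Y)"
  shows "admissible P l (later \<theta> l \<rho> s)"
  using assms
proof (induction s arbitrary: \<rho>)
  case (MMu X s)
  have "admissible P l (later \<theta> l (\<rho>(X := MVar X)) s)"
    by (rule MMu.IH) (use MMu.prems in \<open>auto simp: admissible_simps\<close>)
  moreover have "mf_pol X True (later \<theta> l (\<rho>(X := MVar X)) s)"
    by (rule mf_pol_later) (use MMu.prems in auto)
  ultimately show ?case by (simp add: admissible_simps)
qed (auto simp: admissible_simps)

lemma admissible_initial:
  assumes "mf_wf s" "mf_tvars s \<subseteq> P" "\<forall>d\<in>mf_tests s. is_ltl d"
    and "\<And>d p. d \<in> mf_tests s \<Longrightarrow> p \<in> mf_tvars s \<Longrightarrow> is_ltl (\<theta> p d)"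
    and "\<And>Y. mf_fv (\<rho> Y) = {}" "\<And>Y. admissible P l (\<rho> Y)"
  shows "admissible P l (initial \<theta> l \<rho> s) \<and> mf_fv (initial \<theta> l \<rho> s) = {}"
  using assms
proof (induction s arbitrary: \<rho>)
  case (MVar X)
  then show ?case by (simp add: admissible_simps) (simp add: MFalse_def)
next
  case (MNext l' s)
  have "admissible P l (later \<theta> l \<rho> s)"
    by (rule admissible_later) (use MNext.prems in auto)
  then show ?case using mf_fv_later[of \<theta> l \<rho> s] MNext.prems(5) by auto
next
  case (MMu X s)
  have "admissible P l (later \<theta> l \<rho> (MMu X s))"
    by (rule admissible_later) (use MMu.prems in auto)
  moreover have "mf_fv (later \<theta> l \<rho> (MMu X s)) = {}"
    using mf_fv_later[of \<theta> l \<rho> "MMu X s"] MMu.prems(5) by auto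
  ultimately show ?case unfolding initial.simps(6)
    by (intro MMu.IH) (use MMu.prems in \<open>auto simp del: later.simps\<close>)
qed (auto simp: admissible_simps)

text \<open>Whether a trace has an early change is unknown when the formula is written, so the
  formula branches on it; \<open>A\<close> collects the trace variables whose test
  succeeded.\<close>

primrec split_cases :: "(nat \<Rightarrow> 'a tf) \<Rightarrow> (nat set \<Rightarrow> ('a, 'n) mf) \<Rightarrow> nat list \<Rightarrow> nat set
    \<Rightarrow> ('a, 'n) mf" where
  "split_cases \<kappa> F [] A = F A"
| "split_cases \<kappa> F (p # ps) A =
     MOr (MAnd (MTest (\<kappa> p) p) (split_cases \<kappa> F ps (insert p A)))
         (MAnd (MNot (MTest (\<kappa> p) p)) (split_cases \<kappa> F ps A))"

lemma gsem_split_cases: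
  "k \<in> gsem t nx W (split_cases \<kappa> F ps A) \<longleftrightarrow> k \<in> gsem t nx W (F (A \<union> {p \<in> set ps. t (\<kappa> p) p k}))"
proof (induction ps arbitrary: A)
  case (Cons p ps)
  have "insert p A \<union> {q \<in> set ps. t (\<kappa> q) q k} = A \<union> {q \<in> set (p # ps). t (\<kappa> q) q k}"
    if "t (\<kappa> p) p k" using that by auto
  moreover have "A \<union> {q \<in> set ps. t (\<kappa> q) q k} = A \<union> {q \<in> set (p # ps). t (\<kappa> q) q k}"
    if "\<not> t (\<kappa> p) p k" using that by auto
  ultimately show ?case by (cases "t (\<kappa> p) p k") (simp_all add: Cons.IH del: Un_insert_left)
qed simp

lemma admissible_split_cases:
  assumes "\<And>A. admissible P l (F A) \<and> mf_fv (F A) = {}" "\<And>p. p \<in> set ps \<Longrightarrow> p \<in> P \<and> is_ltl (\<kappa> p)"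
  shows "admissible P l (split_cases \<kappa> F ps A) \<and> mf_fv (split_cases \<kappa> F ps A) = {}"
  using assms(2) by (induction ps arbitrary: A) (auto simp: admissible_simps assms(1))

lemma finite_mf_tvars: "finite (mf_tvars s)"
  by (induction s) auto

lemma finite_mf_tests: "finite (mf_tests s)"
  by (induction s) auto

text \<open>After an early change the stuttering path, from its first step on, is one position ahead
  of the mumbling path, so tests get one next operator; otherwise they must also look past one more
  mumbling step.\<close>

definition mumble :: "'a slabel \<Rightarrow> ('a, 'a slabel) mf \<Rightarrow> ('a, 'a mlabel) mf" where
  "mumble G s = (let D = (\<lambda>p. change_formula (G p)) in
     split_cases (\<lambda>p. early_change (D p))
       (\<lambda>A. initial (\<lambda>p d. if p \<in> A then TNext SG d else after_next (D p) d) D (\<lambda>_. MFalse) s)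
       (sorted_list_of_set (mf_tvars s)) {})"

lemma funpow_mstep: "(mstep D Pi ^^ k) v p = (succ_delta (D p) (Pi p) ^^ k) (v p)"
  by (induction k) (simp_all add: mstep_def)

lemma funpow_sstep: "(sstep G Pi ^^ k) v p = (succ_gamma (G p) (Pi p) ^^ k) (v p)"
  by (induction k) (simp_all add: sstep_def)

lemma admissible_mumble:
  assumes "mf_wf s" "mf_tvars s \<subseteq> P" "\<forall>d\<in>mf_tests s. is_ltl d"
    and "\<And>p. finite (G p)" "\<And>p. \<forall>d\<in>G p. is_ltl d"
  shows "admissible P (\<lambda>p. change_formula (G p)) (mumble G s) \<and> mf_fv (mumble G s) = {}"
  unfolding mumble_def Let_def
proof (intro admissible_split_cases admissible_initial)
  fix p
  have "is_ltl (change_formula (G p))" using assms(4,5) by (rule is_ltl_change_formula)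
  then show "d \<in> mf_tests s \<Longrightarrow>
      is_ltl (if p \<in> A then TNext SG d else after_next (change_formula (G p)) d)" for d A
    using assms(3) by (simp add: is_ltl_after_next ltl_next)
  show "p \<in> set (sorted_list_of_set (mf_tvars s)) \<Longrightarrow>
      p \<in> P \<and> is_ltl (early_change (change_formula (G p)))"
    using \<open>is_ltl (change_formula (G p))\<close> assms(2) finite_mf_tvars[of s]
    by (auto intro: is_ltl_early_change)
qed (use assms(1-3) in \<open>auto simp: admissible_simps MFalse_def\<close>)

text \<open>Both sides become words along their paths; \<open>split_cases\<close> selects the actual
  set of early traces, and \<open>stuttering_path_eq\<close> supplies the relation between the words
  for \<open>gsem_initial\<close>.\<close>

lemma msem_mumble:
  assumes "mf_wf s" "mf_fv s = {}" "mf_labels s \<subseteq> {G}" "\<forall>d\<in>mf_tests s. is_ltl d"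
    and "\<And>p. finite (G p)" "\<And>p. \<forall>d\<in>G p. is_ltl d"
  shows "(\<lambda>_. 0) \<in> msem mstep Pi (\<lambda>_. {}) (mumble G s) \<longleftrightarrow> (\<lambda>_. 0) \<in> msem sstep Pi (\<lambda>_. {}) s"
proof -
  let ?D = "\<lambda>p. change_formula (G p)"
  let ?t' = "\<lambda>d p k. (mstep ?D Pi ^^ k) (\<lambda>_. 0) p \<in> tsem0 (Pi p) d"
  let ?t = "\<lambda>d p k. (sstep G Pi ^^ k) (\<lambda>_. 0) p \<in> tsem0 (Pi p) d"
  let ?A = "{} \<union> {p \<in> set (sorted_list_of_set (mf_tvars s)). ?t' (early_change (?D p)) p 0}"
  let ?\<theta> = "\<lambda>p d. if p \<in> ?A then TNext SG d else after_next (?D p) d"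
  have ltl: "is_ltl (?D p)" for p using assms(5,6) by (rule is_ltl_change_formula)
  have adm: "admissible (mf_tvars s) ?D (mumble G s) \<and> mf_fv (mumble G s) = {}"
    by (rule admissible_mumble) (use assms in auto)
  have "(\<lambda>_. 0) \<in> msem mstep Pi (\<lambda>_. {}) (mumble G s) \<longleftrightarrow> 0 \<in> gsem ?t' (\<lambda>_. Suc) (\<lambda>_. {}) (mumble G s)"
    by (rule msem_along_path[where l = ?D]) (use adm in \<open>auto simp: admissible_def\<close>)
  also have "\<dots> \<longleftrightarrow> 0 \<in> gsem ?t' (\<lambda>_. Suc) (\<lambda>_. {}) (initial ?\<theta> ?D (\<lambda>_. MFalse) s)"
    unfolding mumble_def Let_def by (rule gsem_split_cases)
  also have "\<dots> \<longleftrightarrow> 0 \<in> gsem ?t (\<lambda>_. Suc) (\<lambda>_. {}) s"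
  proof (rule gsem_initial[OF assms(1)])
    fix d p k assume "d \<in> mf_tests s" and p: "p \<in> mf_tvars s"
    then have d: "is_ltl d" using assms(4) by blast
    have path: "(sstep G Pi ^^ Suc k) (\<lambda>_. 0) p =
      (if 0 \<in> tsem0 (Pi p) (early_change (?D p)) then Suc ((mstep ?D Pi ^^ k) (\<lambda>_. 0) p)
       else Suc (succ_delta (?D p) (Pi p) ((mstep ?D Pi ^^ k) (\<lambda>_. 0) p)))"
      unfolding funpow_mstep funpow_sstep by (rule stuttering_path_eq[OF assms(5,6)])
    have "p \<in> ?A \<longleftrightarrow> 0 \<in> tsem0 (Pi p) (early_change (?D p))"
      using p finite_mf_tvars[of s] by simp
    then show "?t' (?\<theta> p d) p k = ?t d p (Suc k)"
      unfolding path by (simp add: tsem0_simps tsem0_after_next[OF ltl d] del: funpow.simps)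
  qed (use assms(2) in \<open>auto simp: MFalse_def\<close>)
  also have "\<dots> \<longleftrightarrow> (\<lambda>_. 0) \<in> msem sstep Pi (\<lambda>_. {}) s"
    by (rule msem_along_path[symmetric, where l = G]) (use assms in auto)
  finally show ?thesis .
qed

section \<open>Transfer through the quantifier prefix\<close>

primrec map_matrix :: "(('a, 'n) mf \<Rightarrow> ('b, 'k) mf) \<Rightarrow> ('a, 'n) hf \<Rightarrow> ('b, 'k) hf" where
  "map_matrix g (HEx p f) = HEx p (map_matrix g f)"
| "map_matrix g (HAll p f) = HAll p (map_matrix g f)"
| "map_matrix g (HBody s) = HBody (g s)"

lemma hf_matrix_map_matrix: "hf_matrix (map_matrix g f) = g (hf_matrix f)"
  by (induction f) auto

lemma hf_bound_map_matrix: "hf_bound (map_matrix g f) = hf_bound f"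
  by (induction f) auto

lemma hsat_map_matrix:
  assumes "\<And>Pi. (\<lambda>_. 0) \<in> msem st Pi (\<lambda>_. {}) (g (hf_matrix f)) \<longleftrightarrow> (\<lambda>_. 0) \<in> msem st' Pi (\<lambda>_. {}) (hf_matrix f)"
  shows "hsat st T Pi (map_matrix g f) \<longleftrightarrow> hsat st' T Pi f"
  using assms by (induction f arbitrary: Pi) auto

lemma stuttering_label:
  assumes "stuttering_ltl_unique f"
  obtains G where "mf_labels (hf_matrix f) \<subseteq> {G}" "\<And>p. finite (G p)" "\<And>p. \<forall>d\<in>G p. is_ltl d"
proof (cases "mf_labels (hf_matrix f) = {}")
  case True
  \<comment> \<open>Without next operators any label will do; empty sets meet all
    requirements.\<close>
  then show thesis using that[of "\<lambda>_. {}"] by simp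
next
  case False
  then obtain G where "G \<in> mf_labels (hf_matrix f)" by blast
  with assms that[of G] show thesis
    unfolding stuttering_ltl_unique_def hf_unique_def hf_basis_ltl_def hf_base_def slab_def by blast
qed

lemma mumbling_at_least_as_expressive:
  "at_least_as_expressive mumbling_ltl_unique (hmodels mstep) stuttering_ltl_unique (hmodels sstep)"
  unfolding at_least_as_expressive_def
proof (intro allI impI)
  fix f :: "('a, 'a slabel) hf"
  let ?s = "hf_matrix f"
  assume f: "stuttering_ltl_unique f"
  obtain G where G: "mf_labels ?s \<subseteq> {G}" "\<And>p. finite (G p)" "\<And>p. \<forall>d\<in>G p. is_ltl d"
    using stuttering_label[OF f] by metis
  have s: "mf_wf ?s" "mf_fv ?s = {}" "\<forall>d\<in>mf_tests ?s. is_ltl d" "mf_tvars ?s \<subseteq> hf_bound f"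
    using f unfolding stuttering_ltl_unique_def hf_closed_wf_def hf_basis_ltl_def hf_base_def by auto
  let ?f = "map_matrix (mumble G) f"
  let ?D = "\<lambda>p. change_formula (G p)"
  have "admissible (hf_bound f) ?D (mumble G ?s) \<and> mf_fv (mumble G ?s) = {}"
    by (rule admissible_mumble) (use s G in auto)
  moreover have "is_ltl (?D p)" for p using G(2,3) by (rule is_ltl_change_formula)
  ultimately have "mumbling_ltl_unique ?f"
    unfolding mumbling_ltl_unique_def hf_closed_wf_def hf_basis_ltl_def hf_base_def hf_unique_def
      hf_matrix_map_matrix hf_bound_map_matrix admissible_def mlab_def
    by (auto intro!: is_ltl_closed_wf dest: subset_singletonD)
  moreover have "hmodels mstep T ?f = hmodels sstep T f" for T
    unfolding hmodels_def
    by (intro hsat_map_matrix msem_mumble) (use s G in auto)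
  ultimately show "\<exists>f'. mumbling_ltl_unique f' \<and> (\<forall>T. hmodels mstep T f' = hmodels sstep T f)"
    by blast
qed

section \<open>Stretching a word\<close>

text \<open>These are the monotone surjections of positions: reading \<open>w\<close> through
  \<open>h\<close> repeats letters of \<open>w\<close>.\<close>

definition stutter_map :: "(nat \<Rightarrow> nat) \<Rightarrow> bool" where
  "stutter_map h \<longleftrightarrow> h 0 = 0 \<and> (\<forall>j. h (Suc j) = h j \<or> h (Suc j) = Suc (h j)) \<and> (\<forall>l. \<exists>k. l \<le> h k)"

lemma stutter_map_mono:
  assumes "stutter_map h" "i \<le> j"
  shows "h i \<le> h j"
proof -
  have "h k \<le> h (Suc k)" for k
    using assms(1) unfolding stutter_map_def by (metis le_refl le_SucI)
  then show ?thesis using assms(2) by (rule lift_Suc_mono_le)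
qed

text \<open>A discrete intermediate value argument, taking the first position from \<open>j\<close>
  on that reaches level \<open>l\<close>.\<close>

lemma stutter_map_reach:
  assumes "stutter_map h" "h j \<le> l"
  obtains k where "j \<le> k" "h k = l" "\<And>i. j \<le> i \<Longrightarrow> i < k \<Longrightarrow> h i < l"
proof -
  obtain k0 where "l \<le> h k0" using assms(1) unfolding stutter_map_def by blast
  then have "l \<le> h (j + k0)" using stutter_map_mono[OF assms(1), of k0 "j + k0"] by simp
  then have ex: "\<exists>k. j \<le> k \<and> l \<le> h k" by (metis le_add1)
  define k where "k = (LEAST k. j \<le> k \<and> l \<le> h k)"
  have k: "j \<le> k" "l \<le> h k" using LeastI_ex[OF ex] unfolding k_def by auto
  have below: "h i < l" if "j \<le> i" "i < k" for i
    using not_less_Least[of i "\<lambda>k. j \<le> k \<and> l \<le> h k"] that unfolding k_def by auto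
  have "h k = l"
  proof (cases "k = j")
    case False
    then obtain k' where k': "k = Suc k'" "j \<le> k'" using k(1) by (cases k) auto
    then have "h k' < l" using below by simp
    then show ?thesis using k(2) assms(1) k'(1) unfolding stutter_map_def by (metis le_antisym Suc_leI nat_less_le)
  qed (use k assms(2) in auto)
  with k below show thesis using that by blast
qed

text \<open>Until does not notice repeated letters, only next operators do. Their arguments have
  size below \<open>B\<close>, and for these \<open>stall\<close> equates the values at a repeated
  letter and its successor.\<close>

lemma tsem0_stutter_map:
  assumes h: "stutter_map h"
    and stall: "\<And>j d. is_ltl d \<Longrightarrow> size d < B \<Longrightarrow> h (Suc j) = h j \<Longrightarrow>
      h j \<in> tsem0 w d \<longleftrightarrow> Suc (h j) \<in> tsem0 w d"
    and "is_ltl d" "size d \<le> B"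
  shows "j \<in> tsem0 (\<lambda>j. w (h j)) d \<longleftrightarrow> h j \<in> tsem0 w d"
  using assms(3,4)
proof (induction d arbitrary: j)
  case (ltl_ap p)
  then show ?case by (simp add: tsem0_simps)
next
  case (ltl_not d)
  then show ?case by (simp add: tsem0_simps)
next
  case (ltl_or d1 d2)
  then show ?case by (simp add: tsem0_simps)
next
  case (ltl_next d)
  then have "j \<in> tsem0 (\<lambda>j. w (h j)) (TNext SG d) \<longleftrightarrow> h (Suc j) \<in> tsem0 w d"
    by (simp add: tsem0_simps)
  also have "\<dots> \<longleftrightarrow> Suc (h j) \<in> tsem0 w d"
  proof (cases "h (Suc j) = h j")
    case True
    then show ?thesis using stall[of d j] ltl_next by simp
  next
    case False
    then show ?thesis using h unfolding stutter_map_def by metis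
  qed
  finally show ?case by (simp add: tsem0_simps)
next
  case (ltl_until d1 d2 Y)
  have IH: "i \<in> tsem0 (\<lambda>j. w (h j)) d1 \<longleftrightarrow> h i \<in> tsem0 w d1"
    "i \<in> tsem0 (\<lambda>j. w (h j)) d2 \<longleftrightarrow> h i \<in> tsem0 w d2" for i
    using ltl_until.IH ltl_until.prems by (auto simp: TUntil_def TAnd_def)
  note until = tsem0_TUntil_iff[OF ltl_until.hyps]
  show ?case
  proof
    assume "j \<in> tsem0 (\<lambda>j. w (h j)) (TUntil Y d1 d2)"
    then obtain k where k: "j \<le> k" "h k \<in> tsem0 w d2"
      "\<And>i. j \<le> i \<Longrightarrow> i < k \<Longrightarrow> h i \<in> tsem0 w d1"
      unfolding until IH by blast
    have "l \<in> tsem0 w d1" if l: "h j \<le> l" "l < h k" for l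
    proof -
      obtain i where "j \<le> i" "h i = l" using stutter_map_reach[OF h l(1)] by metis
      moreover have "i < k"
        using stutter_map_mono[OF h, of k i] l(2) \<open>h i = l\<close> by (meson not_le)
      ultimately show ?thesis using k(3) by blast
    qed
    with k stutter_map_mono[OF h k(1)] show "h j \<in> tsem0 w (TUntil Y d1 d2)"
      unfolding until by blast
  next
    assume "h j \<in> tsem0 w (TUntil Y d1 d2)"
    then obtain l where l: "h j \<le> l" "l \<in> tsem0 w d2"
      "\<And>i. h j \<le> i \<Longrightarrow> i < l \<Longrightarrow> i \<in> tsem0 w d1"
      unfolding until by blast
    obtain k where "j \<le> k" "h k = l" "\<And>i. j \<le> i \<Longrightarrow> i < k \<Longrightarrow> h i < l"
      using stutter_map_reach[OF h l(1)] by metis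
    with l stutter_map_mono[OF h] show "j \<in> tsem0 (\<lambda>j. w (h j)) (TUntil Y d1 d2)"
      unfolding until IH by blast
  qed
qed

section \<open>Stuttering steps in stretched words\<close>

definition differ :: "'a tf set \<Rightarrow> 'a trace \<Rightarrow> nat \<Rightarrow> nat \<Rightarrow> bool" where
  "differ g tr i j \<longleftrightarrow> (\<exists>d\<in>g. (i \<in> tsem0 tr d) \<noteq> (j \<in> tsem0 tr d))"

lemma succ_gamma_eq_Least_differ:
  "succ_gamma g tr i = (if \<exists>j>i. differ g tr i j then LEAST j. i < j \<and> differ g tr i j else Suc i)"
  unfolding succ_gamma_def differ_def by auto

text \<open>The successor is the first preimage of the successor in \<open>w\<close>. Assumption
  \<open>ex\<close> excludes the default step, which moves by one letter even where \<open>h\<close>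
  stalls.\<close>

lemma succ_gamma_stutter_map:
  assumes h: "stutter_map h"
    and val: "\<And>d j. d \<in> g \<Longrightarrow> j \<in> tsem0 t d \<longleftrightarrow> h j \<in> tsem0 w d"
    and ex: "\<exists>l>h j. differ g w (h j) l"
  shows "h (succ_gamma g t j) = succ_gamma g w (h j)"
proof -
  have differ: "differ g t i i' \<longleftrightarrow> differ g w (h i) (h i')" for i i'
    unfolding differ_def using val by auto
  define l where "l = (LEAST l. h j < l \<and> differ g w (h j) l)"
  have l: "h j < l" "differ g w (h j) l" using LeastI_ex[OF ex] unfolding l_def by auto
  have w: "succ_gamma g w (h j) = l" using ex unfolding succ_gamma_eq_Least_differ l_def by simp
  obtain k where k: "j \<le> k" "h k = l" "\<And>i. j \<le> i \<Longrightarrow> i < k \<Longrightarrow> h i < l"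
    using stutter_map_reach[OF h less_imp_le[OF l(1)]] by metis
  have "j < k" using k l(1) by (cases "j = k") auto
  moreover have "(LEAST i. j < i \<and> differ g t j i) = k"
  proof (rule Least_equality)
    show "j < k \<and> differ g t j k" using \<open>j < k\<close> l k(2) differ by auto
    fix i assume i: "j < i \<and> differ g t j i"
    then have "h j \<noteq> h i" unfolding differ by (auto simp: differ_def)
    then have "h j < h i" using stutter_map_mono[OF h, of j i] i by simp
    then have "l \<le> h i" unfolding l_def using i differ by (intro Least_le) auto
    then show "k \<le> i" using k(3)[of i] i by (meson leI less_imp_le not_le)
  qed
  ultimately have "succ_gamma g t j = k"
    unfolding succ_gamma_eq_Least_differ using l k(2) differ by auto
  with w k(2) show ?thesis by simp
qed

section \<open>Periodic words\<close>

lemma tsem0_periodic: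
  assumes "\<And>i. w (i + P) = w i" "is_ltl d"
  shows "i + P \<in> tsem0 w d \<longleftrightarrow> i \<in> tsem0 w d"
  using assms(2)
proof (induction d arbitrary: i)
  case (ltl_ap p)
  then show ?case by (simp add: tsem0_simps assms(1))
next
  case (ltl_next d)
  then show ?case using ltl_next.IH[of "Suc i"] by (simp add: tsem0_simps)
next
  case (ltl_until d1 d2 Y)
  note until = tsem0_TUntil_iff[OF ltl_until.hyps]
  show ?case
  proof
    assume "i + P \<in> tsem0 w (TUntil Y d1 d2)"
    then obtain k where k: "i + P \<le> k" "k \<in> tsem0 w d2"
      "\<And>j. i + P \<le> j \<Longrightarrow> j < k \<Longrightarrow> j \<in> tsem0 w d1" unfolding until by blast
    have "j \<in> tsem0 w d1" if "i \<le> j" "j < k - P" for j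
      using k(3)[of "j + P"] ltl_until.IH(1)[of j] that by simp
    moreover have "k - P \<in> tsem0 w d2" using k(1,2) ltl_until.IH(2)[of "k - P"] by simp
    ultimately show "i \<in> tsem0 w (TUntil Y d1 d2)"
      unfolding until using k(1) by (intro exI[of _ "k - P"]) auto
  next
    assume "i \<in> tsem0 w (TUntil Y d1 d2)"
    then obtain k where k: "i \<le> k" "k \<in> tsem0 w d2"
      "\<And>j. i \<le> j \<Longrightarrow> j < k \<Longrightarrow> j \<in> tsem0 w d1" unfolding until by blast
    have "j \<in> tsem0 w d1" if "i + P \<le> j" "j < k + P" for j
      using k(3)[of "j - P"] ltl_until.IH(1)[of "j - P"] that by simp
    moreover have "k + P \<in> tsem0 w d2" using k(2) ltl_until.IH(2) by simp
    ultimately show "i + P \<in> tsem0 w (TUntil Y d1 d2)"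
      unfolding until using k(1) by (intro exI[of _ "k + P"]) auto
  qed
qed (simp_all add: tsem0_simps)

lemma periodic_mult:
  fixes f :: "nat \<Rightarrow> 'b"
  assumes "\<And>i. k \<le> i \<Longrightarrow> f (i + P) = f i" "k \<le> i"
  shows "f (i + c * P) = f i"
proof (induction c)
  case (Suc c)
  have "f (i + Suc c * P) = f ((i + c * P) + P)" by (simp add: algebra_simps)
  then show ?case using assms(1)[of "i + c * P"] assms(2) Suc by simp
qed simp

lemma periodic_mod:
  fixes f :: "nat \<Rightarrow> 'b"
  assumes "\<And>i. f (i + P) = f i"
  shows "f (i mod P) = f i"
  using periodic_mult[of 0 f P "i mod P" "i div P"] assms by simp

text \<open>A formula that varies differs from its value at \<open>i\<close> at \<open>i0\<close> or
  at \<open>j0\<close>, and the period carries this witness beyond \<open>i\<close>.\<close>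

lemma differ_always:
  assumes "\<And>i. w (i + P) = w i" "0 < P" "\<forall>d\<in>g. is_ltl d" "differ g w i0 j0"
  shows "\<exists>j>i. differ g w i j"
proof -
  obtain j where j: "differ g w i j"
    using assms(4) unfolding differ_def by blast
  have "(j + Suc i * P \<in> tsem0 w d) = (j \<in> tsem0 w d)" if "d \<in> g" for d
    using periodic_mult[of 0 "\<lambda>i. i \<in> tsem0 w d" P j "Suc i"]
      tsem0_periodic[where w = w and P = P, OF assms(1)] assms(3) that by (simp del: mult_Suc)
  then have "differ g w i (j + Suc i * P)" using j unfolding differ_def by blast
  moreover have "i < j + Suc i * P"
    using assms(2) by (cases P) simp_all
  ultimately show ?thesis by blast
qed

text \<open>Modulo the period, a path is thus a deterministic run over finitely many states.\<close>

lemma succ_gamma_periodic: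
  assumes w: "\<And>i. w (i + P) = w i" "0 < P" and "\<forall>d\<in>g. is_ltl d" "differ g w i0 j0"
  shows "succ_gamma g w i mod P = succ_gamma g w (i mod P) mod P"
proof -
  note ex = differ_always[OF w assms(3,4)]
  have differ: "differ g w (i + P) (j + P) \<longleftrightarrow> differ g w i j" for i j
    unfolding differ_def using tsem0_periodic[where w = w and P = P, OF w(1)] assms(3) by auto
  have "succ_gamma g w (i + P) = succ_gamma g w i + P" for i
  proof -
    define l where "l = (LEAST j. i < j \<and> differ g w i j)"
    have l: "i < l" "differ g w i l" using LeastI_ex[OF ex[of i]] unfolding l_def by auto
    have "(LEAST j. i + P < j \<and> differ g w (i + P) j) = l + P"
    proof (rule Least_equality)
      show "i + P < l + P \<and> differ g w (i + P) (l + P)" using l differ by simp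
      fix j assume j: "i + P < j \<and> differ g w (i + P) j"
      then have "differ g w i (j - P)" using differ[of i "j - P"] by simp
      then have "l \<le> j - P" unfolding l_def using j by (intro Least_le) auto
      then show "l + P \<le> j" using j by linarith
    qed
    then show ?thesis using ex[of i] ex[of "i + P"] unfolding succ_gamma_eq_Least_differ l_def by simp
  qed
  then have "succ_gamma g w (i + P) mod P = succ_gamma g w i mod P" for i by simp
  from periodic_mod[of "\<lambda>i. succ_gamma g w i mod P", OF this, of i] show ?thesis by simp
qed

lemma eventually_periodic:
  fixes b :: "nat \<Rightarrow> 'b"
  assumes "finite (range b)" "\<And>k. b (Suc k) = F (b k)"
  obtains k q where "0 < q" "\<And>i. k \<le> i \<Longrightarrow> b (i + q) = b i"
proof -
  have "\<not> inj b" using assms(1) by (metis finite_imageD infinite_UNIV_nat)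
  then obtain k k' where "b k = b k'" "k < k'"
    unfolding inj_def by (metis linorder_neqE_nat)
  then have eq: "b (k + (k' - k)) = b k" by simp
  have "b (i + (k' - k)) = b i" if "k \<le> i" for i
    using that by (induction rule: dec_induct) (use eq assms(2) in auto)
  then show thesis using that[of "k' - k" k] \<open>k < k'\<close> by simp
qed

section \<open>Block words\<close>

text \<open>The blocks alternate forever, which makes the whole word periodic.\<close>

definition block_word :: "nat \<Rightarrow> 'a trace" where
  "block_word N i = (if odd (i div N) then {undefined} else {}, MInt)"

lemma block_word_periodic: "0 < N \<Longrightarrow> block_word N (i + 2 * N) = block_word N i"
  by (simp add: block_word_def)

text \<open>Nested next operators look ahead no further than the size of the formula, so early in a
  block they see only equal letters. For until, the one-step unfolding reduces the claim to the
  arguments.\<close>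

lemma tsem0_block_word_Suc:
  assumes "is_ltl d" "i mod N + size d + 1 < N"
  shows "i \<in> tsem0 (block_word N) d \<longleftrightarrow> Suc i \<in> tsem0 (block_word N) d"
  using assms
proof (induction d arbitrary: i)
  case (ltl_ap p)
  then have "Suc i div N = i div N" by (simp add: div_Suc mod_Suc)
  then show ?case by (simp add: tsem0_simps block_word_def)
next
  case (ltl_not d)
  then show ?case by (simp add: tsem0_simps)
next
  case (ltl_or d1 d2)
  then show ?case by (simp add: tsem0_simps)
next
  case (ltl_next d)
  then show ?case using ltl_next.IH[of "Suc i"] by (simp add: tsem0_simps mod_Suc)
next
  case (ltl_until d1 d2 Y)
  have "i \<in> tsem0 (block_word N) d1 \<longleftrightarrow> Suc i \<in> tsem0 (block_word N) d1"
    "i \<in> tsem0 (block_word N) d2 \<longleftrightarrow> Suc i \<in> tsem0 (block_word N) d2"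
    using ltl_until.IH ltl_until.prems by (simp_all add: TUntil_def TAnd_def)
  then show ?case
    using tsem0_TUntil_unfold[OF ltl_until.hyps, of _ "block_word N" Y] by metis
qed

text \<open>The first two blocks, of length \<open>N\<close> each, are stretched to length \<open>m\<close> and \<open>n\<close> by repeating
  their first letter.\<close>

definition stretch :: "nat \<Rightarrow> nat \<Rightarrow> nat \<Rightarrow> nat \<Rightarrow> nat" where
  "stretch N m n j = (if j < m then j - (m - N) else N + (j - m - (n - N)))"

definition stretched_word :: "nat \<Rightarrow> nat \<Rightarrow> nat \<Rightarrow> 'a trace" where
  "stretched_word N m n = (\<lambda>j. block_word N (stretch N m n j))"

lemma stutter_map_stretch:
  assumes "0 < N" "N \<le> m" "N \<le> n"
  shows "stutter_map (stretch N m n)"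
  unfolding stutter_map_def
proof (intro conjI allI)
  fix l
  show "\<exists>k. l \<le> stretch N m n k"
    by (rule exI[of _ "m + n + l"]) (use assms in \<open>simp add: stretch_def\<close>)
qed (use assms in \<open>auto simp: stretch_def\<close>)

lemma tsem0_stretched_word:
  assumes "N \<le> m" "N \<le> n" "is_ltl d" "size d + 1 < N"
  shows "j \<in> tsem0 (stretched_word N m n) d \<longleftrightarrow> stretch N m n j \<in> tsem0 (block_word N) d"
  unfolding stretched_word_def
proof (rule tsem0_stutter_map[where B = "size d"])
  show "stutter_map (stretch N m n)" using assms by (intro stutter_map_stretch) auto
  fix j and e :: "'a tf"
  assume e: "is_ltl e" "size e < size d" "stretch N m n (Suc j) = stretch N m n j"
  \<comment> \<open>Only first letters of blocks are repeated, so at a stall a whole block of length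
    \<open>N\<close> still lies ahead.\<close>
  then have "stretch N m n j mod N = 0"
    using assms(1,2,4) unfolding stretch_def by (auto split: if_splits)
  then show "stretch N m n j \<in> tsem0 (block_word N) e \<longleftrightarrow> Suc (stretch N m n j) \<in> tsem0 (block_word N) e"
    using e assms(4) by (intro tsem0_block_word_Suc) auto
qed (use assms in auto)

text \<open>If some formula of \<open>g\<close> varies on the block word, the path projects to one
  independent of \<open>m\<close> and \<open>n\<close>. Otherwise every step is the default one, and
  the position equals the number of steps.\<close>

lemma stuttering_path_stretched_word:
  assumes N: "N \<le> m" "N \<le> n" "0 < N"
    and g: "\<forall>d\<in>g. is_ltl d \<and> size d + 1 < N" and d: "is_ltl d" "size d + 1 < N"
  shows "(succ_gamma g (stretched_word N m n) ^^ k) 0 \<in> tsem0 (stretched_word N m n) d \<longleftrightarrow>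
    (if \<exists>i j. differ g (block_word N) i j then (succ_gamma g (block_word N) ^^ k) 0
     else stretch N m n k) \<in> tsem0 (block_word N) d"
proof -
  let ?h = "stretch N m n" and ?w = "block_word N :: 'a trace"
  let ?t = "stretched_word N m n :: 'a trace"
  note h = stutter_map_stretch[OF N(3,1,2)]
  have val: "e \<in> g \<Longrightarrow> j \<in> tsem0 ?t e \<longleftrightarrow> ?h j \<in> tsem0 ?w e" for e j
    using g N by (intro tsem0_stretched_word) auto
  have "?h ((succ_gamma g ?t ^^ k) 0) =
    (if \<exists>i j. differ g ?w i j then (succ_gamma g ?w ^^ k) 0 else ?h k)"
  proof (cases "\<exists>i j. differ g ?w i j")
    case True
    then obtain i j where ij: "differ g ?w i j" by blast
    have ex: "\<exists>l>i. differ g ?w i l" for i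
      by (rule differ_always[where P = "2 * N", OF _ _ _ ij]) (use g N block_word_periodic in auto)
    have "?h ((succ_gamma g ?t ^^ k) 0) = (succ_gamma g ?w ^^ k) 0"
      using h by (induction k) (simp_all add: stutter_map_def succ_gamma_stutter_map[OF h val ex])
    with True show ?thesis by simp
  next
    case False
    then have "\<not> differ g ?t i j" for i j using val unfolding differ_def by blast
    then have "(succ_gamma g ?t ^^ k) 0 = k"
      by (induction k) (simp_all add: succ_gamma_eq_Least_differ)
    with False show ?thesis by simp
  qed
  then show ?thesis using tsem0_stretched_word[OF N(1,2) d] by metis
qed

section \<open>Pumping the length of the second block\<close>

lemma hsat_singleton:
  "hsat st {t} Pi f \<longleftrightarrow>
    (\<lambda>_. 0) \<in> msem st (\<lambda>p. if p \<in> hf_bound f then t else Pi p) (\<lambda>_. {}) (hf_matrix f)"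
proof (induction f arbitrary: Pi)
  case (HEx p f)
  have "(\<lambda>q. if q \<in> hf_bound f then t else (Pi(p := t)) q)
    = (\<lambda>q. if q \<in> hf_bound (HEx p f) then t else Pi q)" by auto
  then show ?case using HEx[of "Pi(p := t)"] by (simp del: fun_upd_apply)
next
  case (HAll p f)
  have "(\<lambda>q. if q \<in> hf_bound f then t else (Pi(p := t)) q)
    = (\<lambda>q. if q \<in> hf_bound (HAll p f) then t else Pi q)" by auto
  then show ?case using HAll[of "Pi(p := t)"] by (simp del: fun_upd_apply)
qed simp

lemma stuttering_indistinguishable:
  fixes f :: "('a, 'a slabel) hf"
  assumes f: "stuttering_ltl_unique f"
  obtains N m n n' where "0 < N" "N \<le> m" "N \<le> n" "n < m" "m \<le> n'"
    "hmodels sstep {stretched_word N m n} f \<longleftrightarrow> hmodels sstep {stretched_word N m n'} f"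
proof -
  let ?s = "hf_matrix f"
  obtain G where G: "mf_labels ?s \<subseteq> {G}" "\<And>p. finite (G p)" "\<And>p. \<forall>d\<in>G p. is_ltl d"
    using stuttering_label[OF f] by metis
  have s: "mf_wf ?s" "mf_fv ?s = {}" "\<forall>d\<in>mf_tests ?s. is_ltl d" "mf_tvars ?s \<subseteq> hf_bound f"
    using f unfolding stuttering_ltl_unique_def hf_closed_wf_def hf_basis_ltl_def hf_base_def by auto
  \<comment> \<open>Only trace variables of the matrix are considered, since a label is a total map
    whose values elsewhere may have unbounded size.\<close>
  have "finite (size ` (mf_tests ?s \<union> (\<Union>p\<in>mf_tvars ?s. G p)))"
    using finite_mf_tests finite_mf_tvars G(2) by blast
  then obtain N0 where N0: "\<forall>x \<in> size ` (mf_tests ?s \<union> (\<Union>p\<in>mf_tvars ?s. G p)). x < N0"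
    by (auto simp: finite_nat_set_iff_bounded)
  define N where "N = Suc N0"
  have N: "0 < N" "d \<in> mf_tests ?s \<Longrightarrow> size d + 1 < N"
    "p \<in> mf_tvars ?s \<Longrightarrow> d \<in> G p \<Longrightarrow> size d + 1 < N" for d p
    using N0 unfolding N_def by auto
  let ?w = "block_word N :: 'a trace"
  \<comment> \<open>\<open>V\<close> contains the variables whose paths notice changes; the others
    move letter by letter.\<close>
  define V where "V = {p \<in> mf_tvars ?s. \<exists>i j. differ (G p) ?w i j}"
  define v where "v = (\<lambda>k p. (succ_gamma (G p) ?w ^^ k) 0)"
  \<comment> \<open>The joint state of the paths in \<open>V\<close>; reduction modulo the period
    and 0 elsewhere leave finitely many states.\<close>
  define b where "b = (\<lambda>k p. if p \<in> V then v k p mod (2 * N) else 0)"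
  have period: "?w (i + 2 * N) = ?w i" "0 < 2 * N" for i
    using block_word_periodic[OF N(1)] N(1) by auto
  have "finite V" 
    by (rule finite_subset[OF _ finite_mf_tvars[of ?s]]) (auto simp: V_def)
  then have "finite {h. \<forall>p. (p \<in> V \<longrightarrow> h p \<in> {..<2 * N}) \<and> (p \<notin> V \<longrightarrow> h p = 0)}"
    by (rule finite_set_of_finite_funs) simp
  then have "finite (range b)"
    by (rule rev_finite_subset) (use N(1) in \<open>auto simp: b_def\<close>)
  moreover have "b (Suc k) = (\<lambda>p. if p \<in> V then succ_gamma (G p) ?w (b k p) mod (2 * N) else 0)" for k
  proof
    fix p
    show "b (Suc k) p = (if p \<in> V then succ_gamma (G p) ?w (b k p) mod (2 * N) else 0)"
    proof (cases "p \<in> V")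
      case True
      then obtain i j where "differ (G p) ?w i j" unfolding V_def by blast
      from succ_gamma_periodic[OF period G(3) this, of "v k p"] True
      show ?thesis by (simp add: b_def v_def)
    qed (simp add: b_def)
  qed
  ultimately obtain k q where q: "0 < q" "\<And>i. k \<le> i \<Longrightarrow> b (i + q) = b i"
    by (rule eventually_periodic) blast
  have v_periodic: "v (i + e * q) p \<in> tsem0 ?w d \<longleftrightarrow> v i p \<in> tsem0 ?w d"
    if "p \<in> V" "k \<le> i" "is_ltl d" for i e p d
  proof -
    have mod: "j mod (2 * N) \<in> tsem0 ?w d \<longleftrightarrow> j \<in> tsem0 ?w d" for j
      using periodic_mod[of "\<lambda>j. j \<in> tsem0 ?w d"] tsem0_periodic[where w = ?w and P = "2 * N", OF period(1) that(3)] by simp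
    have "b (i + e * q) p = b i p" using periodic_mult[of k b q] q(2) that(2) by simp
    then have "v (i + e * q) p mod (2 * N) = v i p mod (2 * N)" using that(1) by (simp add: b_def)
    then show ?thesis using mod by metis
  qed
  \<comment> \<open>With \<open>m\<close> set to \<open>c + e1 * q\<close> below, \<open>m\<close>
    is \<open>n e1 + 1\<close> and at most \<open>n e2\<close> whenever
    \<open>e1 < e2\<close>.\<close>
  define c where "c = N + k + 1"
  define n where "n = (\<lambda>e. N + k + e * q)"
  \<comment> \<open>The word from step \<open>m\<close> on, written without \<open>m\<close>: on
    \<open>V\<close> periodicity lets \<open>c\<close> replace \<open>m\<close>, and elsewhere the
    second block starts at offset 0. So the pigeonhole principle can be applied to \<open>e\<close>
    before \<open>m\<close> is fixed.\<close>
  define suf where "suf = (\<lambda>e d p i. (if p \<in> V then v (c + i) p else N + (i - (n e - N))) \<in> tsem0 ?w d)"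
  define x where "x = (\<lambda>e. suffix_type (suf e) (\<lambda>_. {}) ?s 0)"
  have "finite {xs :: bool list. length xs = suffix_type_length ?s}"
    using finite_lists_length_eq[of "UNIV :: bool set"] by simp
  then have "finite (range x)"
    by (rule rev_finite_subset) (auto simp: x_def length_suffix_type)
  then have "\<not> inj x" by (metis finite_imageD infinite_UNIV_nat)
  then obtain e1 e2 where e: "x e1 = x e2" "e1 < e2"
    unfolding inj_def by (metis linorder_neqE_nat)
  define m where "m = c + e1 * q"
  define word where
    "word = (\<lambda>e d p i. (if p \<in> V then v i p else stretch N m (n e) i) \<in> tsem0 ?w d)"
  have Nm: "N \<le> m" "N \<le> n e" for e unfolding m_def c_def n_def by auto
  have sat: "hmodels sstep {stretched_word N m (n e)} f \<longleftrightarrow> 0 \<in> gsem (word e) (\<lambda>_. Suc) (\<lambda>_. {}) ?s" for e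
    unfolding hmodels_def hsat_singleton
  proof (rule msem_along_path[where l = G])
    fix d p i assume dp: "d \<in> mf_tests ?s" "p \<in> mf_tvars ?s"
    then have "p \<in> hf_bound f" using s(4) by blast
    then show "word e d p i \<longleftrightarrow> (sstep G (\<lambda>p. if p \<in> hf_bound f then stretched_word N m (n e) else undefined) ^^ i)
        (\<lambda>_. 0) p \<in> tsem0 (if p \<in> hf_bound f then stretched_word N m (n e) else undefined) d"
      unfolding funpow_sstep
      using stuttering_path_stretched_word[OF Nm N(1), of "G p" d i e] dp s(3) G(3) N(2,3)
      by (auto simp: word_def v_def V_def)
  qed (use s G in auto)
  have shift: "suffix_type (word e) (\<lambda>_. {}) ?s m = x e" for e
  proof -
    have suf: "suf e d p i = word e d p (m + i)" if "d \<in> mf_tests ?s" for d p i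
    proof (cases "p \<in> V")
      case True
      then show ?thesis
        using v_periodic[of p "c + i" d e1] s(3) that
        by (simp add: suf_def word_def m_def c_def ac_simps)
    qed (simp add: suf_def word_def stretch_def)
    have "suffix_type (word e) (\<lambda>_. {}) ?s (m + 0) = suffix_type (suf e) (\<lambda>X. (+) m -` {}) ?s 0"
      by (rule suffix_type_shift[OF s(1)]) (rule suf)
    then show ?thesis by (simp add: x_def)
  qed
  \<comment> \<open>Before step \<open>m\<close>, the letter-by-letter paths are in the first block,
    whose length does not depend on \<open>e\<close>.\<close>
  have "suffix_type (word e1) (\<lambda>_. {}) ?s 0 = suffix_type (word e2) (\<lambda>_. {}) ?s 0"
    by (rule suffix_type_append[of _ m]) (use s shift e in \<open>auto simp: word_def stretch_def\<close>)
  from suffix_type_imp_sat[OF s(1) this]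
  have "hmodels sstep {stretched_word N m (n e1)} f \<longleftrightarrow> hmodels sstep {stretched_word N m (n e2)} f"
    unfolding sat .
  moreover have "n e1 < m" by (simp add: n_def m_def c_def)
  moreover have "m \<le> n e2"
  proof -
    have "Suc e1 * q \<le> e2 * q" using e(2) by (intro mult_le_mono1) simp
    then show ?thesis using q(1) by (simp add: n_def m_def c_def)
  qed
  ultimately show thesis using that N(1) Nm by blast
qed

section \<open>A mumbling formula comparing two block lengths\<close>

definition a_then_not_a :: "'a tf" where
  "a_then_not_a = TAnd (TAP undefined) (TNext SG (TNot (TAP undefined)))"

definition race_label :: "'a mlabel" where
  "race_label = (\<lambda>p. if p = 0 then TAP undefined else TTrue)"

text \<open>Moves on until copy 0 is at the end of a block of \<open>a\<close>, then asks whether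
  copy 1 stands on an \<open>a\<close>.\<close>

definition race_matrix :: "('a, 'a mlabel) mf" where
  "race_matrix = MMu 0 (MOr (MAnd (MTest a_then_not_a 0) (MTest (TAP undefined) 1))
     (MAnd (MNot (MTest a_then_not_a 0)) (MNext race_label (MVar 0))))"

definition race :: "('a, 'a mlabel) hf" where
  "race = HEx 0 (HEx 1 (HBody race_matrix))"

lemma is_ltl_race_label: "is_ltl (race_label p)"
  by (simp add: race_label_def is_ltl_TTrue ltl_ap)

lemma is_ltl_a_then_not_a: "is_ltl a_then_not_a"
  unfolding a_then_not_a_def by (intro is_ltl_TAnd is_ltl.intros)

lemma mumbling_race: "mumbling_ltl_unique race"
  using is_ltl_race_label is_ltl_a_then_not_a
  by (auto simp: mumbling_ltl_unique_def hf_closed_wf_def hf_basis_ltl_def hf_base_def hf_unique_def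
      race_def race_matrix_def mlab_def is_ltl_closed_wf ltl_ap)

lemma succ_delta_TTrue: "succ_delta TTrue tr i = Suc i"
  by (auto simp: succ_delta_def mem_tsem0_TTrue intro!: Least_equality)

lemma mem_stretched_word_iff:
  assumes "0 < N" "N \<le> m" "N \<le> n" "j \<le> m + n"
  shows "j \<in> tsem0 (stretched_word N m n) (TAP undefined) \<longleftrightarrow> m \<le> j \<and> j < m + n"
proof -
  have "stretch N m n j div N = (if j < m then 0 else if j < m + n then 1 else 2)"
    using assms by (auto simp: stretch_def div_nat_eqI)
  then show ?thesis by (auto simp: tsem0_simps stretched_word_def block_word_def split: if_splits)
qed

text \<open>Copy 0 jumps to \<open>m\<close> and reaches the last letter of the
  \<open>a\<close>-block at step \<open>n\<close>. Copy 1 is then at position \<open>n\<close>,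
  which carries an \<open>a\<close> exactly if \<open>m \<le> n\<close>.\<close>

lemma hmodels_race_iff:
  assumes N: "0 < N" "N \<le> m" "N \<le> n"
  shows "hmodels mstep {stretched_word N m n :: 'a trace} race \<longleftrightarrow> m \<le> n"
proof -
  let ?t = "stretched_word N m n :: 'a trace" and ?a = "TAP undefined :: 'a tf"
  have a: "j \<in> tsem0 ?t ?a \<longleftrightarrow> m \<le> j \<and> j < m + n" if "j \<le> m + n" for j
    by (rule mem_stretched_word_iff[OF N that])
  define Pi where "Pi = (\<lambda>p. if p \<in> hf_bound (race :: ('a, 'a mlabel) hf) then ?t else undefined)"
  define t where "t = (\<lambda>d p k. (mstep race_label Pi ^^ k) (\<lambda>_. 0) p \<in> tsem0 (Pi p) d)"
  have Pi: "Pi 0 = ?t" "Pi 1 = ?t" by (simp_all add: Pi_def race_def)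
  have path1: "(mstep race_label Pi ^^ k) (\<lambda>_. 0) 1 = k" for k
    unfolding funpow_mstep by (induction k) (simp_all add: race_label_def succ_delta_TTrue)
  have next_a: "succ_delta ?a ?t i = j" if "i < j" "m \<le> j" "j < m + n" "i < m \<Longrightarrow> j = m" "m \<le> i \<Longrightarrow> j = Suc i" for i j
  proof -
    have "(LEAST j. i < j \<and> j \<in> tsem0 ?t ?a) = j"
    proof (rule Least_equality)
      fix l assume "i < l \<and> l \<in> tsem0 ?t ?a"
      then show "j \<le> l" using that a[of l] by (cases "l \<le> m + n"; cases "i < m") (auto simp: not_le)
    qed (use that a in auto)
    moreover have "j \<in> tsem0 ?t ?a" using that a by auto
    ultimately show ?thesis using that(1) unfolding succ_delta_def by auto
  qed
  \<comment> \<open>The first step crosses the empty block, hence the offset between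
    \<open>Suc k\<close> steps and position \<open>m + k\<close>.\<close>
  have path0: "(mstep race_label Pi ^^ Suc k) (\<lambda>_. 0) 0 = m + k" if "Suc k \<le> n" for k
    using that unfolding funpow_mstep Pi race_label_def
  proof (induction k)
    case 0
    then show ?case using N by (auto intro!: next_a)
  next
    case (Suc k)
    then show ?case using N by (auto intro!: next_a)
  qed
  have guard: "t a_then_not_a 0 k \<longleftrightarrow> k = n" if "k \<le> n" for k
  proof (cases k)
    case 0
    then show ?thesis using N a by (simp add: t_def a_then_not_a_def tsem0_simps(2-) Pi)
  next
    case (Suc k')
    have "t a_then_not_a 0 k \<longleftrightarrow> m + k' \<in> tsem0 ?t ?a \<and> Suc (m + k') \<notin> tsem0 ?t ?a"
      unfolding t_def Suc path0[OF that[unfolded Suc]] by (simp add: a_then_not_a_def tsem0_simps(2-) Pi)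
    then show ?thesis using that Suc a by auto
  qed
  have goal: "t ?a 1 n \<longleftrightarrow> m \<le> n"
    unfolding t_def path1 Pi using a[of n] N by auto
  have "hmodels mstep {?t} race \<longleftrightarrow> 0 \<in> gsem t (\<lambda>_. Suc) (\<lambda>_. {}) race_matrix"
    unfolding hmodels_def hsat_singleton Pi_def[symmetric]
    by (subst msem_along_path[where l = race_label and t = t])
      (auto simp: race_def race_matrix_def t_def)
  also have "\<dots> \<longleftrightarrow> m \<le> n"
  proof
    let ?I = "{k. k \<le> n \<longrightarrow> m \<le> n}"
    have "gsem t (\<lambda>_. Suc) (\<lambda>_. {}) race_matrix \<subseteq> ?I"
      unfolding race_matrix_def
    proof (rule gsem_MMu_lowerbound, rule subsetI, rule CollectI, rule impI)
      fix k assume k: "k \<le> n" "k \<in> gsem t (\<lambda>_. Suc) ((\<lambda>_. {})(0 := ?I))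
        (MOr (MAnd (MTest a_then_not_a 0) (MTest ?a 1))
          (MAnd (MNot (MTest a_then_not_a 0)) (MNext race_label (MVar 0))))"
      show "m \<le> n"
      proof (cases "k = n")
        case True
        then show ?thesis using k guard goal by simp
      next
        case False
        then show ?thesis using k guard by simp
      qed
    qed
    then show "0 \<in> gsem t (\<lambda>_. Suc) (\<lambda>_. {}) race_matrix \<Longrightarrow> m \<le> n" by auto
  next
    assume "m \<le> n"
    \<comment> \<open>Every prefixed point contains \<open>n\<close> and, going backwards, all
      earlier steps.\<close>
    have "k \<in> I" if k: "k \<le> n" and I: "gsem t (\<lambda>_. Suc) ((\<lambda>_. {})(0 := I))
        (MOr (MAnd (MTest a_then_not_a 0) (MTest ?a 1))
          (MAnd (MNot (MTest a_then_not_a 0)) (MNext race_label (MVar 0)))) \<subseteq> I" for k I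
      using k
    proof (induction rule: inc_induct)
      case base
      then show ?case using I guard[of n] goal \<open>m \<le> n\<close> by auto
    next
      case (step k)
      then show ?case using I guard[of k] by auto
    qed
    from this[of 0] show "0 \<in> gsem t (\<lambda>_. Suc) (\<lambda>_. {}) race_matrix"
      by (auto simp: race_matrix_def simp del: gsem.simps(1-5))
  qed
  finally show ?thesis .
qed

lemma stuttering_not_at_least_as_expressive:
  "\<not> at_least_as_expressive (stuttering_ltl_unique :: ('a, 'a slabel) hf \<Rightarrow> bool) (hmodels sstep)
    (mumbling_ltl_unique :: ('a, 'a mlabel) hf \<Rightarrow> bool) (hmodels mstep)"
proof
  assume "at_least_as_expressive (stuttering_ltl_unique :: ('a, 'a slabel) hf \<Rightarrow> bool) (hmodels sstep)
    (mumbling_ltl_unique :: ('a, 'a mlabel) hf \<Rightarrow> bool) (hmodels mstep)"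
  then obtain f :: "('a, 'a slabel) hf"
    where f: "stuttering_ltl_unique f" "\<And>T. hmodels sstep T f \<longleftrightarrow> hmodels mstep T race"
    unfolding at_least_as_expressive_def using mumbling_race by blast
  obtain N m n n' where *: "0 < N" "N \<le> m" "N \<le> n" "n < m" "m \<le> n'"
    "hmodels sstep {stretched_word N m n} f \<longleftrightarrow> hmodels sstep {stretched_word N m n'} f"
    using stuttering_indistinguishable[OF f(1)] by metis
  then have "hmodels mstep {stretched_word N m n} (race :: ('a, 'a mlabel) hf)
      \<longleftrightarrow> hmodels mstep {stretched_word N m n'} (race :: ('a, 'a mlabel) hf)"
    using f(2) by simp
  with * show False by (simp add: hmodels_race_iff)
qed

theorem theorem6p4:
  shows "strictly_more_expressive
           (mumbling_ltl_unique :: ('a::finite, 'a mlabel) hf \<Rightarrow> bool) (hmodels mstep)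
           (stuttering_ltl_unique :: ('a, 'a slabel) hf \<Rightarrow> bool) (hmodels sstep)"
  unfolding strictly_more_expressive_def
  using mumbling_at_least_as_expressive stuttering_not_at_least_as_expressive by blast

end
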